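(* Let $\mathbf{X}$ be a represented space and $f:\subseteq\mathbf{X}\to\mathbb{N}^\mathbb{N}$ a single-valued partial function. Then $f\le_{\mathrm W}\mathsf{UC}_{\mathbb{N}^\mathbb{N}}$ if and only if $f\le_{\mathrm W}\widehat{\mathsf{TC}_{\mathbb{N}^\mathbb{N}}}$.
   Context: A represented space is a set $X$ with a partial surjection $\delta_X:\subseteq\mathbb{N}^\mathbb{N}\to X$ (names). A partial $F$ realizes a partial multivalued $f:\subseteq X\rightrightarrows Y$ if for every $x\in\operatorname{dom}(f)$ and name $p$ of $x$, $F(p)$ names an element of $f(x)$. $f\le_{\mathrm W}g$ if there are computable partial $H,K:\subseteq\mathbb{N}^\mathbb{N}\to\mathbb{N}^\mathbb{N}$ such that for every realizer $G$ of $g$, $p\mapsto K(\langle p,G(H(p))\rangle)$ realizes $f$. The parallelization $\widehat g$ takes a sequence $(x_i)_i$ of inputs of $g$ and outputs a sequence $(y_i)_i$ with $y_i\in g(x_i)$. Closed sets $A\subseteq\mathbb{N}^\mathbb{N}$ are named by (characteristic functions of) trees $T\subseteq\mathbb{N}^{<\mathbb{N}}$ whose set of infinite paths is $A$. $\mathsf{UC}_{\mathbb{N}^\mathbb{N}}$ maps each closed singleton $\{x\}$ to $x$. $\mathsf{TC}_{\mathbb{N}^\mathbb{N}}$ is defined on all closed sets and maps $A$ to $\{p\in\mathbb{N}^\mathbb{N}: A\ne\emptyset\Rightarrow p\in A\}$. *)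

theory Defs
  imports "HOL-Analysis.Analysis" "HOL-Library.Nat_Bijection" "HOL-Library.Sublist"
begin

type_synonym baire = "nat \<Rightarrow> nat"

section \<open>Computable partial functions on Baire space\<close>

text \<open>
  Partial recursive functionals: Kleene's schemes with the oracle \<open>p\<close> as an additional
  initial function.  The functions are unary, and several arguments are passed through the
  computable bijection \<^const>\<open>prod_encode\<close>; hence the schemes \<open>fst\<close>, \<open>snd\<close> and \<open>pair\<close>
  take the place of the usual \<open>n\<close>-ary projections and \<open>n\<close>-ary composition.
  \<^const>\<open>None\<close> stands for divergence.
\<close>

primrec prim_rec :: "(nat \<Rightarrow> nat option) \<Rightarrow> (nat \<Rightarrow> nat option) \<Rightarrow> nat \<Rightarrow> nat \<Rightarrow> nat option" where
  "prim_rec g h a 0 = g a"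
| "prim_rec g h a (Suc k) =
     Option.bind (prim_rec g h a k) (\<lambda>r. h (prod_encode (a, prod_encode (k, r))))"

text \<open>As usual, all values tested before the first zero have to be defined.\<close>

definition minimize :: "(nat \<Rightarrow> nat option) \<Rightarrow> nat option" where
  "minimize h = (if \<exists>k. h k = Some 0 \<and> (\<forall>j<k. h j \<noteq> None)
                 then Some (LEAST k. h k = Some 0) else None)"

inductive recursive_functional :: "(baire \<Rightarrow> nat \<Rightarrow> nat option) \<Rightarrow> bool" where
  query: "recursive_functional (\<lambda>p n. Some (p n))"
| zero: "recursive_functional (\<lambda>p n. Some 0)"
| succ: "recursive_functional (\<lambda>p n. Some (Suc n))"
| fst: "recursive_functional (\<lambda>p n. Some (fst (prod_decode n)))"
| snd: "recursive_functional (\<lambda>p n. Some (snd (prod_decode n)))"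
| pair: "recursive_functional (\<lambda>p n.
           Option.bind (F p n) (\<lambda>a. Option.bind (G p n) (\<lambda>b. Some (prod_encode (a, b)))))"
    if "recursive_functional F" and "recursive_functional G"
| comp: "recursive_functional (\<lambda>p n. Option.bind (G p n) (F p))"
    if "recursive_functional F" and "recursive_functional G"
| prec: "recursive_functional (\<lambda>p n. prim_rec (F p) (G p) (fst (prod_decode n)) (snd (prod_decode n)))"
    if "recursive_functional F" and "recursive_functional G"
| mu: "recursive_functional (\<lambda>p n. minimize (\<lambda>k. F p (prod_encode (n, k))))"
    if "recursive_functional F"

text \<open>
  A partial function on Baire space is computable if some algorithm with oracle \<open>p\<close> produces
  all digits of its value whenever \<open>p\<close> is in its domain.  Nothing is required
  outside the domain; since enlarging the domains of \<open>H\<close> and \<open>K\<close> never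
  invalidates a Weihrauch reduction, insisting on the natural domain of the algorithm
  would give the same reducibility.
\<close>

definition computable :: "(baire \<Rightarrow> baire option) \<Rightarrow> bool" where
  "computable F \<longleftrightarrow> (\<exists>\<Phi>. recursive_functional \<Phi> \<and>
     (\<forall>p q. F p = Some q \<longrightarrow> (\<forall>n. \<Phi> p n = Some (q n))))"

definition baire_pair :: "baire \<Rightarrow> baire \<Rightarrow> baire" where
  "baire_pair p q = (\<lambda>n. if even n then p (n div 2) else q (n div 2))"

section \<open>Represented spaces, problems and Weihrauch reducibility\<close>

type_synonym 'x rep = "baire \<Rightarrow> 'x option"

definition represented_space :: "'x set \<Rightarrow> 'x rep \<Rightarrow> bool" where
  "represented_space X \<delta> \<longleftrightarrow> ran \<delta> = X"

text \<open>
  A problem is a partial multivalued function between represented spaces; it is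
  undefined at \<open>x\<close> iff its set of solutions there is empty.
\<close>

record ('x, 'y) problem =
  in_rep :: "'x rep"
  out_rep :: "'y rep"
  solutions :: "'x \<Rightarrow> 'y set"

definition realizes :: "(baire \<Rightarrow> baire option) \<Rightarrow> ('x, 'y) problem \<Rightarrow> bool" where
  "realizes F f \<longleftrightarrow> (\<forall>p x. in_rep f p = Some x \<and> solutions f x \<noteq> {} \<longrightarrow>
     (\<exists>q y. F p = Some q \<and> out_rep f q = Some y \<and> y \<in> solutions f x))"

definition weihrauch_le :: "('x, 'y) problem \<Rightarrow> ('u, 'v) problem \<Rightarrow> bool"
    (infix "\<le>\<^sub>W" 50) where
  "f \<le>\<^sub>W g \<longleftrightarrow> (\<exists>H K. computable H \<and> computable K \<and>
     (\<forall>G. realizes G g \<longrightarrow>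
        realizes (\<lambda>p. Option.bind (H p) (\<lambda>h. Option.bind (G h) (\<lambda>q. K (baire_pair p q)))) f))"

definition seq_rep :: "'x rep \<Rightarrow> (nat \<Rightarrow> 'x) rep" where
  "seq_rep \<delta> p =
     (if \<forall>i. \<delta> (\<lambda>n. p (prod_encode (i, n))) \<noteq> None
      then Some (\<lambda>i. the (\<delta> (\<lambda>n. p (prod_encode (i, n))))) else None)"

definition parallelization :: "('x, 'y) problem \<Rightarrow> (nat \<Rightarrow> 'x, nat \<Rightarrow> 'y) problem" where
  "parallelization g =
     \<lparr> in_rep = seq_rep (in_rep g), out_rep = seq_rep (out_rep g),
       solutions = (\<lambda>xs. {ys. \<forall>i. ys i \<in> solutions g (xs i)}) \<rparr>"

definition baire_rep :: "baire rep" where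
  "baire_rep p = Some p"

definition single_valued_problem :: "'x rep \<Rightarrow> 'y rep \<Rightarrow> ('x \<Rightarrow> 'y option) \<Rightarrow> ('x, 'y) problem" where
  "single_valued_problem \<delta> \<delta>' f =
     \<lparr> in_rep = \<delta>, out_rep = \<delta>', solutions = (\<lambda>x. set_option (f x)) \<rparr>"

section \<open>The problems UC and TC on Baire space\<close>

definition is_tree :: "nat list set \<Rightarrow> bool" where
  "is_tree T \<longleftrightarrow> (\<forall>w\<in>T. \<forall>v. prefix v w \<longrightarrow> v \<in> T)"

definition paths :: "nat list set \<Rightarrow> baire set" where
  "paths T = {x. \<forall>n. map x [0..<n] \<in> T}"

definition coded_set :: "baire \<Rightarrow> nat list set" where
  "coded_set p = {w. p (list_encode w) = 1}"

definition closed_rep :: "baire set rep" where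
  "closed_rep p = (if range p \<subseteq> {0, 1} \<and> is_tree (coded_set p)
                   then Some (paths (coded_set p)) else None)"

definition UC_baire :: "(baire set, baire) problem" where
  "UC_baire = \<lparr> in_rep = closed_rep, out_rep = baire_rep,
     solutions = (\<lambda>A. {x. closed A \<and> A = {x}}) \<rparr>"

definition TC_baire :: "(baire set, baire) problem" where
  "TC_baire = \<lparr> in_rep = closed_rep, out_rep = baire_rep,
     solutions = (\<lambda>A. if closed A then {p. A \<noteq> {} \<longrightarrow> p \<in> A} else {}) \<rparr>"

lemma closed_paths: "closed (paths T)"
proof -
  have cyl: "open {x::baire. map x [0..<n] = w}" for n w
  proof (cases "length w = n")
    case True
    have "{x::baire. map x [0..<n] = w} = (\<Inter>i\<in>{..<n}. (\<lambda>x. x i) -` {w ! i})"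
      using True by (auto simp: list_eq_iff_nth_eq)
    moreover have "open ((\<lambda>x::baire. x i) -` {w ! i})" for i
      by (rule open_vimage) (auto intro: open_discrete continuous_on_product_coordinates)
    ultimately show ?thesis by (auto intro!: open_INT)
  next
    case False
    then have "{x::baire. map x [0..<n] = w} = {}" by auto
    then show ?thesis by (metis open_empty)
  qed
  have "- paths T = (\<Union>n. \<Union>w\<in>-T. {x::baire. map x [0..<n] = w})"
    by (auto simp: paths_def)
  moreover have "open \<dots>" using cyl by (intro open_UN ballI) auto
  ultimately show ?thesis by (simp add: closed_def)
qed

text \<open>The represented space of closed subsets of Baire space is well defined.\<close>

lemma represented_space_closed: "represented_space {A. closed A} closed_rep"
proof -
  have "A \<in> ran closed_rep" if A: "closed A" for A
  proof -
    define T where "T = {map x [0..<n] | x n. x \<in> A}"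
    define p where "p = (\<lambda>k. if list_decode k \<in> T then 1 else 0 :: nat)"
    have p: "coded_set p = T" by (auto simp: coded_set_def p_def)
    have "is_tree T"
      unfolding is_tree_def T_def
    proof (intro ballI allI impI)
      fix w v assume "w \<in> {map x [0..<n] | x n. x \<in> A}" and v: "prefix v w"
      then obtain x n where "x \<in> A" "w = map x [0..<n]" by blast
      moreover have "v = take (length v) w" "length v \<le> length w"
        using v by (auto simp: prefix_def)
      ultimately have "v = map x [0..<length v]" by (simp add: take_map)
      with \<open>x \<in> A\<close> show "v \<in> {map x [0..<n] | x n. x \<in> A}" by blast
    qed
    moreover have "paths T = A"
    proof
      show "A \<subseteq> paths T" by (auto simp: paths_def T_def)
      show "paths T \<subseteq> A"
      proof
        fix y assume y: "y \<in> paths T"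
        have "\<exists>x\<in>A. map y [0..<n] = map x [0..<n]" for n
        proof -
          obtain x m where x: "map y [0..<n] = map x [0..<m]" "x \<in> A"
            using y by (fastforce simp: paths_def T_def)
          then have "n = m" by (metis length_map length_upt diff_zero)
          with x show ?thesis by blast
        qed
        then obtain X where X: "\<And>n. X n \<in> A" "\<And>n. map y [0..<n] = map (X n) [0..<n]"
          by metis
        have "(\<lambda>n. X n i) \<longlonglongrightarrow> y i" for i
        proof (rule tendsto_eventually)
          have "X n i = y i" if "n > i" for n
            using X(2)[of n] that by auto
          then show "\<forall>\<^sub>F n in sequentially. X n i = y i"
            by (meson eventually_gt_at_top eventually_mono)
        qed
        then have "limitin (product_topology (\<lambda>_. euclidean) UNIV) X y sequentially"
          by (simp add: limitin_componentwise)
        then have "X \<longlonglongrightarrow> y"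
          by (simp add: euclidean_product_topology)
        then show "y \<in> A" using A X(1) closed_sequentially by blast
      qed
    qed
    ultimately have "closed_rep p = Some A" by (auto simp: closed_rep_def p) (auto simp: p_def split: if_splits)
    then show ?thesis by (auto simp: ran_def)
  qed
  moreover have "closed A" if "A \<in> ran closed_rep" for A
    using that by (auto simp: ran_def closed_rep_def closed_paths split: if_splits)
  ultimately show ?thesis by (auto simp: represented_space_def)
qed

end

theory Submission
  imports Defs
begin

text \<open>
  The direction from \<open>UC\<close> to the parallelization of \<open>TC\<close> repeats the instance.  Conversely, let a
  name be mapped to trees \<open>T\<^sub>0, T\<^sub>1, \<dots>\<close>, and let \<open>y\<close> be the single possible output.
  Consider the triples \<open>(y, S, r)\<close> such that \<open>r\<^sub>i\<close> is a path of \<open>T\<^sub>i\<close> for every \<open>i \<in> S\<close> and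
  every convergent digit of the outer reduction, run on any answers that agree with \<open>r\<close> on \<open>S\<close>,
  is a digit of \<open>y\<close>.  Taking for \<open>S\<close> the set of all \<open>i\<close> with \<open>T\<^sub>i\<close> ill-founded shows that such
  triples exist; and as \<open>r\<close> on \<open>S\<close> always extends to correct answers, \<open>y\<close> is the same for all
  of them.  This set of triples is closed, effectively in the name, so it remains to compute
  \<open>y\<close> by \<open>UC\<close> from a tree \<open>D\<close> all of whose paths (at least one) project to \<open>y\<close>.

  For this, let two players build paths of \<open>D\<close> digit by digit, one projecting to a sequence with
  value \<open>m\<close> at \<open>n\<close>, the other to a sequence with a different value at \<open>n\<close>; whoever
  gets stuck loses.  One of the two always gets stuck, so the game tree is well-founded, the
  function assigning to each position its least winning move is the unique element of an
  effectively closed set, and the player for \<open>m\<close> wins iff \<open>y n = m\<close>.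
\<close>

section \<open>Total recursive functionals\<close>

definition pfst :: "nat \<Rightarrow> nat" where "pfst n = fst (prod_decode n)"
definition psnd :: "nat \<Rightarrow> nat" where "psnd n = snd (prod_decode n)"
abbreviation pr_code :: "nat \<Rightarrow> nat \<Rightarrow> nat" ("\<langle>_,/ _\<rangle>") where "\<langle>a, b\<rangle> \<equiv> prod_encode (a, b)"

lemma pfst_pair [simp]: "pfst \<langle>a, b\<rangle> = a" and psnd_pair [simp]: "psnd \<langle>a, b\<rangle> = b"
  by (simp_all add: pfst_def psnd_def)

text \<open>The code of the empty list is 0, so these values let the formulas for tails and entries
  of coded lists run past the end with default 0.\<close>

lemma pfst_0 [simp]: "pfst 0 = 0" and psnd_0 [simp]: "psnd 0 = 0"
  using pfst_pair[of 0 0] psnd_pair[of 0 0] by (simp_all add: prod_encode_def)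

lemma pair_pfst_psnd [simp]: "\<langle>pfst n, psnd n\<rangle> = n"
  by (simp add: pfst_def psnd_def)

text \<open>The trees and games below need only total functionals. Partial ones enter solely through
  the two functionals \<open>H\<close> and \<open>K\<close> of a reduction.\<close>

definition total_rec :: "(baire \<Rightarrow> nat \<Rightarrow> nat) \<Rightarrow> bool" where
  "total_rec f \<longleftrightarrow> recursive_functional (\<lambda>p n. Some (f p n))"

abbreviation decidable :: "(baire \<Rightarrow> nat \<Rightarrow> bool) \<Rightarrow> bool" where
  "decidable P \<equiv> total_rec (\<lambda>p n. of_bool (P p n))"

lemma recursive_functional_comp_total:
  assumes "recursive_functional F" "total_rec g"
  shows "recursive_functional (\<lambda>p n. F p (g p n))"
  using recursive_functional.comp[OF assms(1) assms(2)[unfolded total_rec_def]] by simp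

lemma total_rec_comp:
  assumes "total_rec f" "total_rec g"
  shows "total_rec (\<lambda>p n. f p (g p n))"
  using recursive_functional_comp_total[OF assms(1)[unfolded total_rec_def] assms(2)]
  by (simp add: total_rec_def)

named_theorems total_rec_intros

lemma total_rec_pair [total_rec_intros]:
  assumes "total_rec f" "total_rec g"
  shows "total_rec (\<lambda>p n. \<langle>f p n, g p n\<rangle>)"
  using recursive_functional.pair[OF assms[unfolded total_rec_def]] by (simp add: total_rec_def)

lemma total_rec_pfst [total_rec_intros]: "total_rec f \<Longrightarrow> total_rec (\<lambda>p n. pfst (f p n))"
  using total_rec_comp[of "\<lambda>p n. pfst n" f] recursive_functional.fst
  by (simp add: total_rec_def pfst_def)

lemma total_rec_psnd [total_rec_intros]: "total_rec f \<Longrightarrow> total_rec (\<lambda>p n. psnd (f p n))"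
  using total_rec_comp[of "\<lambda>p n. psnd n" f] recursive_functional.snd
  by (simp add: total_rec_def psnd_def)

lemma total_rec_Suc [total_rec_intros]: "total_rec f \<Longrightarrow> total_rec (\<lambda>p n. Suc (f p n))"
  using total_rec_comp[of "\<lambda>p n. Suc n" f] recursive_functional.succ
  by (simp add: total_rec_def)

lemma total_rec_query [total_rec_intros]: "total_rec f \<Longrightarrow> total_rec (\<lambda>p n. p (f p n))"
  using total_rec_comp[of "\<lambda>p n. p n" f] recursive_functional.query
  by (simp add: total_rec_def)

text \<open>The identity is not an initial scheme, but pairing the two projections yields
  it.\<close>

lemma total_rec_id [total_rec_intros]: "total_rec (\<lambda>p n. n)"
proof -
  have "total_rec (\<lambda>p n. \<langle>pfst n, psnd n\<rangle>)"
    using recursive_functional.pair[OF recursive_functional.fst recursive_functional.snd]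
    by (simp add: total_rec_def pfst_def psnd_def)
  then show ?thesis by simp
qed

lemma total_rec_const [total_rec_intros]: "total_rec (\<lambda>p n. k)"
proof (induction k)
  case 0
  show ?case using recursive_functional.zero by (simp add: total_rec_def)
qed (rule total_rec_Suc)

text \<open>The premise on \<open>h\<close> follows the nesting
  \<open>\<langle>n, \<langle>k, r\<rangle>\<rangle>\<close> in which \<open>prim_rec\<close> passes
  parameter, counter and previous value.\<close>

lemma total_rec_rec_nat [total_rec_intros]:
  assumes g: "total_rec g"
    and h: "total_rec (\<lambda>p m. h p (pfst m) (pfst (psnd m)) (psnd (psnd m)))"
    and b: "total_rec b"
  shows "total_rec (\<lambda>p n. rec_nat (g p n) (\<lambda>k r. h p n k r) (b p n))"
proof -
  define G where "G = (\<lambda>p n. Some (g p n))"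
  define R where "R = (\<lambda>p m. Some (h p (pfst m) (pfst (psnd m)) (psnd (psnd m))))"
  have "prim_rec (G p) (R p) a k = Some (rec_nat (g p a) (h p a) k)" for p a k
    by (induction k) (simp_all add: G_def R_def)
  then have "total_rec (\<lambda>p n. rec_nat (g p (pfst n)) (h p (pfst n)) (psnd n))"
    using recursive_functional.prec[of G R] g h
    by (simp add: total_rec_def G_def R_def pfst_def psnd_def)
  from total_rec_comp[OF this total_rec_pair[OF total_rec_id b]] show ?thesis
    by simp
qed

section \<open>Arithmetic and decidable predicates\<close>

lemma total_rec_add [total_rec_intros]:
  assumes "total_rec f" "total_rec g"
  shows "total_rec (\<lambda>p n. f p n + g p n)"
proof -
  have "a + b = rec_nat a (\<lambda>_. Suc) b" for a b :: nat by (induction b) auto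
  then show ?thesis by (simp only:) (intro total_rec_intros assms)
qed

lemma total_rec_diff [total_rec_intros]:
  assumes "total_rec f" "total_rec g"
  shows "total_rec (\<lambda>p n. f p n - g p n)"
proof -
  have 1: "b - 1 = rec_nat 0 (\<lambda>k _. k) b" for b :: nat by (cases b) auto
  have "a - b = rec_nat a (\<lambda>_ r. rec_nat 0 (\<lambda>k _. k) r) b" for a b :: nat
    by (induction b) (auto simp: 1[symmetric])
  then show ?thesis by (simp only:) (intro total_rec_intros assms)
qed

lemma total_rec_if [total_rec_intros]:
  assumes "decidable P" "total_rec f" "total_rec g"
  shows "total_rec (\<lambda>p n. if P p n then f p n else g p n)"
proof -
  \<comment> \<open>The truth value is the number of recursion steps: none keeps \<open>b\<close>,
    one replaces it by \<open>a\<close>.\<close>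
  have "(if c then a else b) = rec_nat b (\<lambda>_ _. a) (of_bool c)" for a b :: nat and c by simp
  then show ?thesis
    by (simp only:) (intro total_rec_intros assms total_rec_comp[OF assms(2)])
qed

lemma decidable_eq [total_rec_intros]:
  assumes "total_rec f" "total_rec g"
  shows "decidable (\<lambda>p n. f p n = g p n)"
proof -
  have "of_bool (a = b) = 1 - ((a - b) + (b - a))" for a b :: nat by auto
  then show ?thesis by (simp only:) (intro total_rec_intros assms)
qed

lemma decidable_less [total_rec_intros]:
  assumes "total_rec f" "total_rec g"
  shows "decidable (\<lambda>p n. f p n < g p n)"
proof -
  have "of_bool (a < b) = 1 - (Suc a - b)" for a b :: nat by auto
  then show ?thesis by (simp only:) (intro total_rec_intros assms)
qed

lemma decidable_le [total_rec_intros]: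
  assumes "total_rec f" "total_rec g"
  shows "decidable (\<lambda>p n. f p n \<le> g p n)"
proof -
  have "of_bool (a \<le> b) = 1 - (a - b)" for a b :: nat by auto
  then show ?thesis by (simp only:) (intro total_rec_intros assms)
qed

lemma decidable_not [total_rec_intros]:
  assumes "decidable P"
  shows "decidable (\<lambda>p n. \<not> P p n)"
proof -
  have "of_bool (\<not> c) = 1 - (of_bool c :: nat)" for c by simp
  then show ?thesis by (simp only:) (intro total_rec_intros assms)
qed

lemma decidable_conj [total_rec_intros]:
  assumes "decidable P" "decidable Q"
  shows "decidable (\<lambda>p n. P p n \<and> Q p n)"
proof -
  have "of_bool (c \<and> d) = (if c then of_bool d else 0 :: nat)" for c d by simp
  then show ?thesis by (simp only:) (intro total_rec_intros assms)
qed

lemma decidable_imp [total_rec_intros]: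
  assumes "decidable P" "decidable Q"
  shows "decidable (\<lambda>p n. P p n \<longrightarrow> Q p n)"
proof -
  have "of_bool (c \<longrightarrow> d) = (if c then of_bool d else 1 :: nat)" for c d by simp
  then show ?thesis by (simp only:) (intro total_rec_intros assms)
qed

lemma decidable_disj [total_rec_intros]:
  assumes "decidable P" "decidable Q"
  shows "decidable (\<lambda>p n. P p n \<or> Q p n)"
proof -
  have "of_bool (c \<or> d) = (if c then 1 else of_bool d :: nat)" for c d by simp
  then show ?thesis by (simp only:) (intro total_rec_intros assms)
qed

lemma decidable_all_less [total_rec_intros]:
  assumes P: "decidable (\<lambda>p m. P p (pfst m) (psnd m))" and b: "total_rec b"
  shows "decidable (\<lambda>p n. \<forall>k<b p n. P p n k)"
proof -
  have eq: "of_bool (\<forall>k<b. Q k) = rec_nat 1 (\<lambda>k r. if Q k then r else 0) b" for b :: nat and Q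
    by (induction b) (auto simp: less_Suc_eq)
  \<comment> \<open>The step of the recursion receives
    \<open>\<langle>n, \<langle>k, r\<rangle>\<rangle>\<close>, from which the predicate must pick
    \<open>n\<close> and \<open>k\<close>.\<close>
  have "decidable (\<lambda>p m. P p (pfst m) (pfst (psnd m)))"
    using total_rec_comp[OF P, of "\<lambda>p m. \<langle>pfst m, pfst (psnd m)\<rangle>"]
    by (simp add: total_rec_intros)
  then show ?thesis
    unfolding eq by (intro total_rec_intros b)
qed

lemma decidable_even [total_rec_intros]:
  assumes "total_rec f"
  shows "decidable (\<lambda>p n. even (f p n))"
proof -
  have "of_bool (even a) = (rec_nat 1 (\<lambda>_ r. 1 - r) a :: nat)" for a :: nat by (induction a) auto
  then show ?thesis by (simp only:) (intro total_rec_intros assms)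
qed

lemma total_rec_half [total_rec_intros]:
  assumes "total_rec f"
  shows "total_rec (\<lambda>p n. f p n div 2)"
proof -
  have "a div 2 = rec_nat 0 (\<lambda>k r. if even k then r else Suc r) a" for a :: nat
    by (induction a) auto
  then show ?thesis by (simp only:) (intro total_rec_intros assms)
qed

lemma total_rec_double [total_rec_intros]:
  "total_rec f \<Longrightarrow> total_rec (\<lambda>p n. 2 * f p n)"
  unfolding mult_2 by (intro total_rec_intros)

section \<open>Codes of finite sequences\<close>

definition list_len :: "nat \<Rightarrow> nat" where
  "list_len c = length (list_decode c)"

text \<open>The default 0 turns every code into a point of Baire space that can serve as an
  oracle.\<close>

definition list_nth :: "nat \<Rightarrow> nat \<Rightarrow> nat" where
  "list_nth c i = (if i < list_len c then list_decode c ! i else 0)"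

text \<open>A nonempty list is coded as the successor of the pair of head and coded tail, so
  \<open>psnd (r - 1)\<close> codes the tail; the code 0 of the empty list is a fixed point.\<close>

definition list_drop :: "nat \<Rightarrow> nat \<Rightarrow> nat" where
  "list_drop c i = rec_nat c (\<lambda>_ r. psnd (r - 1)) i"

lemma list_decode_list_drop: "list_decode (list_drop c i) = drop i (list_decode c)"
proof (induction i)
  case (Suc i)
  have "list_decode (psnd (r - 1)) = tl (list_decode r)" for r
    by (cases r) (simp, simp add: psnd_def split: prod.splits)
  then show ?case using Suc by (simp add: list_drop_def drop_Suc tl_drop)
qed (simp add: list_drop_def)

lemma list_drop_eq_0: "list_drop c i = 0 \<longleftrightarrow> list_len c \<le> i"
  by (metis drop_eq_Nil list_decode.simps(1) list_decode_inverse list_decode_list_drop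
      list_encode.simps(1) list_len_def)

text \<open>Provides the bound for the recursion that computes the length by counting nonempty
  suffixes.\<close>

lemma list_len_le: "list_len c \<le> c"
proof -
  have "length xs \<le> list_encode xs" for xs
    by (induction xs) (auto intro: order.trans le_prod_encode_2)
  from this[of "list_decode c"] show ?thesis by (simp add: list_len_def)
qed

lemma total_rec_list_drop [total_rec_intros]:
  assumes "total_rec f" "total_rec g"
  shows "total_rec (\<lambda>p n. list_drop (f p n) (g p n))"
  unfolding list_drop_def by (intro total_rec_intros assms)

lemma total_rec_list_len [total_rec_intros]:
  assumes "total_rec f"
  shows "total_rec (\<lambda>p n. list_len (f p n))"
proof -
  have "rec_nat 0 (\<lambda>k r. if list_drop c k = 0 then r else Suc r) b = min (list_len c) b" for b c
    by (induction b) (auto simp: list_drop_eq_0)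
  from this[of c c for c] have
    "list_len c = rec_nat 0 (\<lambda>k r. if list_drop c k = 0 then r else Suc r) c" for c
    using list_len_le[of c] by simp
  then show ?thesis
    by (simp only:) (intro total_rec_intros assms total_rec_comp[OF assms])
qed

lemma total_rec_list_nth [total_rec_intros]:
  assumes "total_rec f" "total_rec g"
  shows "total_rec (\<lambda>p n. list_nth (f p n) (g p n))"
proof -
  have "list_nth c i = pfst (list_drop c i - 1)" for c i
  proof (cases "i < list_len c")
    case True
    then obtain k where k: "list_drop c i = Suc k"
      using list_drop_eq_0[of c i] not0_implies_Suc by auto
    have "drop i (list_decode c) = list_decode c ! i # drop (Suc i) (list_decode c)"
      using True by (simp add: list_len_def Cons_nth_drop_Suc)
    then show ?thesis
      using True list_decode_list_drop[of c i] k
      by (auto simp: list_nth_def pfst_def split: prod.splits)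
  next
    case False
    then have "list_drop c i = 0" by (simp add: list_drop_eq_0)
    with False show ?thesis
      by (simp add: list_nth_def)
  qed
  then show ?thesis by (simp only:) (intro total_rec_intros assms)
qed

lemma total_rec_baire_pair [total_rec_intros]:
  assumes "total_rec (\<lambda>p m. f p (pfst m) (psnd m))" "total_rec (\<lambda>p m. g p (pfst m) (psnd m))"
    and a: "total_rec a"
  shows "total_rec (\<lambda>p n. baire_pair (\<lambda>i. f p n i) (\<lambda>i. g p n i) (a p n))"
proof -
  have "total_rec (\<lambda>p n. f p n (a p n div 2))"
    using total_rec_comp[OF assms(1), of "\<lambda>p n. \<langle>n, a p n div 2\<rangle>"]
    by (simp add: total_rec_intros a)
  moreover have "total_rec (\<lambda>p n. g p n (a p n div 2))"
    using total_rec_comp[OF assms(2), of "\<lambda>p n. \<langle>n, a p n div 2\<rangle>"]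
    by (simp add: total_rec_intros a)
  ultimately show ?thesis
    unfolding baire_pair_def by (intro total_rec_intros a)
qed

section \<open>Substitution of computed oracles\<close>

text \<open>By induction on the schemes, each query to \<open>q\<close> becomes a call of
  \<open>G\<close>. As \<open>q\<close> may depend on a parameter \<open>c\<close>, this parameter
  has to travel with every argument. \<open>G\<close> may diverge elsewhere.\<close>

lemma oracle_substitution:
  assumes "recursive_functional \<Phi>" and G: "recursive_functional G"
  shows "\<exists>\<Phi>'. recursive_functional \<Phi>' \<and>
    (\<forall>p c q. (\<forall>i. G p \<langle>c, i\<rangle> = Some (q i)) \<longrightarrow> (\<forall>n. \<Phi>' p \<langle>c, n\<rangle> = \<Phi> q n))"
  using assms(1)
proof induction
  case query
  then show ?case using G by auto
next
  case zero
  show ?case by (rule exI[of _ "\<lambda>p n. Some 0"]) (simp add: recursive_functional.zero)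
next
  case succ
  have "total_rec (\<lambda>p m. Suc (psnd m))" by (intro total_rec_intros)
  then show ?case by (intro exI[of _ "\<lambda>p m. Some (Suc (psnd m))"]) (simp add: total_rec_def)
next
  case fst
  have "total_rec (\<lambda>p m. pfst (psnd m))" by (intro total_rec_intros)
  then show ?case
    by (intro exI[of _ "\<lambda>p m. Some (pfst (psnd m))"]) (simp add: total_rec_def, simp add: pfst_def)
next
  case snd
  have "total_rec (\<lambda>p m. psnd (psnd m))" by (intro total_rec_intros)
  then show ?case
    by (intro exI[of _ "\<lambda>p m. Some (psnd (psnd m))"]) (simp add: total_rec_def, simp add: psnd_def)
next
  case (pair F F2)
  then obtain A B where A: "recursive_functional A"
      "\<And>p c q n. (\<forall>i. G p \<langle>c, i\<rangle> = Some (q i)) \<Longrightarrow> A p \<langle>c, n\<rangle> = F q n"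
    and B: "recursive_functional B"
      "\<And>p c q n. (\<forall>i. G p \<langle>c, i\<rangle> = Some (q i)) \<Longrightarrow> B p \<langle>c, n\<rangle> = F2 q n"
    by metis
  show ?case
  proof (intro exI conjI allI impI)
    fix p c q n
    assume "\<forall>i. G p \<langle>c, i\<rangle> = Some (q i)"
    from A(2)[OF this] B(2)[OF this]
    show "Option.bind (A p \<langle>c, n\<rangle>) (\<lambda>a. Option.bind (B p \<langle>c, n\<rangle>) (\<lambda>b. Some \<langle>a, b\<rangle>)) =
        Option.bind (F q n) (\<lambda>a. Option.bind (F2 q n) (\<lambda>b. Some \<langle>a, b\<rangle>))"
      by simp
  qed (rule recursive_functional.pair[OF A(1) B(1)])
next
  case (comp F F2)
  then obtain A B where A: "recursive_functional A"
      "\<And>p c q n. (\<forall>i. G p \<langle>c, i\<rangle> = Some (q i)) \<Longrightarrow> A p \<langle>c, n\<rangle> = F q n"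
    and B: "recursive_functional B"
      "\<And>p c q n. (\<forall>i. G p \<langle>c, i\<rangle> = Some (q i)) \<Longrightarrow> B p \<langle>c, n\<rangle> = F2 q n"
    by metis
  \<comment> \<open>The parameter is paired again with the intermediate result before
    \<open>A\<close> is called.\<close>
  define C where "C = (\<lambda>p m. Option.bind
      (Option.bind (Some (pfst m)) (\<lambda>a. Option.bind (B p m) (\<lambda>b. Some \<langle>a, b\<rangle>))) (A p))"
  have "recursive_functional C"
    unfolding C_def using total_rec_pfst[OF total_rec_id]
    by (intro recursive_functional.comp recursive_functional.pair A B) (simp add: total_rec_def)
  moreover have "C p \<langle>c, n\<rangle> = Option.bind (F2 q n) (F q)"
    if "\<forall>i. G p \<langle>c, i\<rangle> = Some (q i)" for p c q n
    using A(2)[OF that] B(2)[OF that] by (simp add: C_def)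
  ultimately show ?case by auto
next
  case (prec F F2)
  then obtain A B where A: "recursive_functional A"
      "\<And>p c q n. (\<forall>i. G p \<langle>c, i\<rangle> = Some (q i)) \<Longrightarrow> A p \<langle>c, n\<rangle> = F q n"
    and B: "recursive_functional B"
      "\<And>p c q n. (\<forall>i. G p \<langle>c, i\<rangle> = Some (q i)) \<Longrightarrow> B p \<langle>c, n\<rangle> = F2 q n"
    by metis
  \<comment> \<open>The recursion runs with the parameter \<open>\<langle>c, a\<rangle>\<close>, so
    its step sees \<open>\<langle>\<langle>c, a\<rangle>, \<langle>k, r\<rangle>\<rangle>\<close>
    and has to rebracket for \<open>B\<close>.\<close>
  define B' where "B' = (\<lambda>p m. B p \<langle>pfst (pfst m), \<langle>psnd (pfst m), psnd m\<rangle>\<rangle>)"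
  have "recursive_functional B'"
    unfolding B'_def by (intro recursive_functional_comp_total[OF B(1)] total_rec_intros)
  from recursive_functional.prec[OF A(1) this]
  have "recursive_functional (\<lambda>p m. prim_rec (A p) (B' p) (pfst m) (psnd m))"
    by (simp add: pfst_def psnd_def)
  from recursive_functional_comp_total[OF this, of "\<lambda>p m. \<langle>\<langle>pfst m, pfst (psnd m)\<rangle>, psnd (psnd m)\<rangle>"]
  have "recursive_functional
      (\<lambda>p m. prim_rec (A p) (B' p) \<langle>pfst m, pfst (psnd m)\<rangle> (psnd (psnd m)))"
    by (simp add: total_rec_intros)
  moreover have "prim_rec (A p) (B' p) \<langle>c, a\<rangle> k = prim_rec (F q) (F2 q) a k"
    if "\<forall>i. G p \<langle>c, i\<rangle> = Some (q i)" for p c q a k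
    by (induction k) (simp_all add: B'_def A(2)[OF that] B(2)[OF that])
  ultimately show ?case
    unfolding pfst_def[symmetric] psnd_def[symmetric]
    by (intro exI[of _ "\<lambda>p m. prim_rec (A p) (B' p) \<langle>pfst m, pfst (psnd m)\<rangle> (psnd (psnd m))"]) simp
next
  case (mu F)
  then obtain A where A: "recursive_functional A"
      "\<And>p c q n. (\<forall>i. G p \<langle>c, i\<rangle> = Some (q i)) \<Longrightarrow> A p \<langle>c, n\<rangle> = F q n"
    by metis
  have "recursive_functional (\<lambda>p m. A p \<langle>pfst (pfst m), \<langle>psnd (pfst m), psnd m\<rangle>\<rangle>)"
    by (intro recursive_functional_comp_total[OF A(1)] total_rec_intros)
  from recursive_functional.mu[OF this] have "recursive_functional
      (\<lambda>p n. minimize (\<lambda>k. A p \<langle>pfst n, \<langle>psnd n, k\<rangle>\<rangle>))" by simp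
  moreover have "minimize (\<lambda>k. A p \<langle>c, \<langle>n, k\<rangle>\<rangle>) = minimize (\<lambda>k. F q \<langle>n, k\<rangle>)"
    if "\<forall>i. G p \<langle>c, i\<rangle> = Some (q i)" for p c q n
    by (simp add: A(2)[OF that])
  ultimately show ?case
    by (intro exI[of _ "\<lambda>p n. minimize (\<lambda>k. A p \<langle>pfst n, \<langle>psnd n, k\<rangle>\<rangle>)"]) simp
qed

text \<open>Here the parameter \<open>c\<close> is the argument \<open>n\<close> itself, so the
  oracle may vary with the input.\<close>

lemma total_rec_substitution:
  assumes \<Phi>: "total_rec \<Phi>" and g: "total_rec (\<lambda>p m. g p (pfst m) (psnd m))" and b: "total_rec b"
  shows "total_rec (\<lambda>p n. \<Phi> (\<lambda>i. g p n i) (b p n))"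
proof -
  obtain \<Phi>' where "recursive_functional \<Phi>'"
    and "\<And>p c n. \<Phi>' p \<langle>c, n\<rangle> = Some (\<Phi> (g p c) n)"
    using oracle_substitution[OF \<Phi>[unfolded total_rec_def] g[unfolded total_rec_def]] by auto
  from recursive_functional_comp_total[OF this(1) total_rec_pair[OF total_rec_id b]] this(2)
  show ?thesis by (simp add: total_rec_def)
qed

lemma total_rec_comp2:
  assumes "total_rec (\<lambda>p m. f p (pfst m) (psnd m))" "total_rec a" "total_rec b"
  shows "total_rec (\<lambda>p n. f p (a p n) (b p n))"
  using total_rec_comp[OF assms(1) total_rec_pair[OF assms(2,3)]] by simp

text \<open>Two oracles are read off one by the interleaving that \<open>baire_pair\<close>
  produces. Below, the first is the given data and the second a point of the closed set under
  consideration.\<close>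

abbreviation total_rec2 :: "(baire \<Rightarrow> baire \<Rightarrow> nat \<Rightarrow> nat) \<Rightarrow> bool" where
  "total_rec2 F \<equiv> total_rec (\<lambda>q n. F (\<lambda>i. q (2 * i)) (\<lambda>i. q (Suc (2 * i))) n)"

abbreviation decidable2 :: "(baire \<Rightarrow> baire \<Rightarrow> nat \<Rightarrow> bool) \<Rightarrow> bool" where
  "decidable2 P \<equiv> total_rec2 (\<lambda>p q n. of_bool (P p q n))"

lemma total_rec2_substitution:
  assumes F: "total_rec2 F" and f: "total_rec (\<lambda>p m. f p (pfst m) (psnd m))"
    and g: "total_rec (\<lambda>p m. g p (pfst m) (psnd m))" and b: "total_rec b"
  shows "total_rec (\<lambda>p n. F (\<lambda>i. f p n i) (\<lambda>i. g p n i) (b p n))"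
proof -
  have "total_rec (\<lambda>p m. baire_pair (f p (pfst m)) (g p (pfst m)) (psnd m))"
    by (intro total_rec_intros total_rec_comp2[OF f] total_rec_comp2[OF g])
  from total_rec_substitution[OF F this b] show ?thesis
    by (simp add: baire_pair_def)
qed

lemma computable_precompose:
  assumes "computable K" "total_rec g"
  shows "computable (\<lambda>r. K (g r))"
proof -
  obtain \<Phi> where \<Phi>: "recursive_functional \<Phi>" "\<And>p q n. K p = Some q \<Longrightarrow> \<Phi> p n = Some (q n)"
    using assms(1) by (auto simp: computable_def)
  have "total_rec (\<lambda>p m. g p (psnd m))"
    by (rule total_rec_comp[OF assms(2)]) (intro total_rec_intros)
  from oracle_substitution[OF \<Phi>(1) this[unfolded total_rec_def]]
  obtain \<Phi>' where \<Phi>': "recursive_functional \<Phi>'" "\<And>p c n. \<Phi>' p \<langle>c, n\<rangle> = \<Phi> (g p) n"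
    by auto
  have "recursive_functional (\<lambda>p n. \<Phi>' p \<langle>0, n\<rangle>)"
    by (intro recursive_functional_comp_total[OF \<Phi>'(1)] total_rec_intros)
  with \<Phi> \<Phi>'(2) show ?thesis
    unfolding computable_def by (intro exI[of _ "\<lambda>p n. \<Phi>' p \<langle>0, n\<rangle>"] conjI) auto
qed

text \<open>\<open>g\<close> may use the original name as well as the output of \<open>H\<close>.
  The latter can diverge, so the new oracle is a partial functional that is total wherever
  \<open>H\<close> is defined.\<close>

lemma computable_postcompose:
  assumes "computable H" "total_rec g"
  shows "computable (\<lambda>p. map_option (\<lambda>h. g (baire_pair p h)) (H p))"
proof -
  obtain \<Phi> where \<Phi>: "recursive_functional \<Phi>" "\<And>p q n. H p = Some q \<Longrightarrow> \<Phi> p n = Some (q n)"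
    using assms(1) by (auto simp: computable_def)
  \<comment> \<open>Both candidate digits are computed, and the stored parity bit then selects one
    of them.\<close>
  define B where "B = (\<lambda>p m. Option.bind (Option.bind (Some \<langle>of_bool (even (psnd m)), p (psnd m div 2)\<rangle>)
      (\<lambda>a. Option.bind (\<Phi> p (psnd m div 2)) (\<lambda>b. Some \<langle>a, b\<rangle>)))
      (\<lambda>c. Some (if pfst (pfst c) = 1 then psnd (pfst c) else psnd c)))"
  have "total_rec (\<lambda>p m. \<langle>of_bool (even (psnd m)), p (psnd m div 2)\<rangle>)"
    "total_rec (\<lambda>p c. if pfst (pfst c) = 1 then psnd (pfst c) else psnd c)"
    by (intro total_rec_intros)+
  moreover have "recursive_functional (\<lambda>p m. \<Phi> p (psnd m div 2))"
    by (intro recursive_functional_comp_total[OF \<Phi>(1)] total_rec_intros)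
  ultimately have B: "recursive_functional B"
    unfolding B_def total_rec_def by (intro recursive_functional.comp recursive_functional.pair)
  have B2: "B p \<langle>0, i\<rangle> = Some (baire_pair p h i)" if "H p = Some h" for p h i
    using \<Phi>(2)[OF that] by (simp add: B_def baire_pair_def)
  obtain \<Phi>' where \<Phi>': "recursive_functional \<Phi>'"
      "\<And>p c q n. (\<forall>i. B p \<langle>c, i\<rangle> = Some (q i)) \<Longrightarrow> \<Phi>' p \<langle>c, n\<rangle> = Some (g q n)"
    using oracle_substitution[OF assms(2)[unfolded total_rec_def] B] by metis
  have "recursive_functional (\<lambda>p n. \<Phi>' p \<langle>0, n\<rangle>)"
    by (intro recursive_functional_comp_total[OF \<Phi>'(1)] total_rec_intros)
  with B2 \<Phi>'(2) show ?thesis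
    unfolding computable_def by (intro exI[of _ "\<lambda>p n. \<Phi>' p \<langle>0, n\<rangle>"] conjI) auto
qed

section \<open>Finite approximations and effectively closed sets\<close>

definition option_code :: "nat option \<Rightarrow> nat" where
  "option_code v = (case v of None \<Rightarrow> 0 | Some k \<Rightarrow> Suc k)"

lemma option_code_simps [simp]:
  "option_code None = 0" "option_code (Some k) = Suc k"
  "option_code v = 0 \<longleftrightarrow> v = None" "option_code v = Suc k \<longleftrightarrow> v = Some k"
  by (auto simp: option_code_def split: option.splits)

text \<open>The parameter \<open>N\<close> bounds both the oracle positions that are read and the searches of the
  minimization operator, so that the approximations are total.\<close>

definition approximates ::
    "(baire \<Rightarrow> nat \<Rightarrow> nat \<Rightarrow> nat option) \<Rightarrow> (baire \<Rightarrow> nat \<Rightarrow> nat option) \<Rightarrow> bool" where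
  "approximates A \<Phi> \<longleftrightarrow>
     total_rec (\<lambda>p m. option_code (A p (pfst m) (psnd m))) \<and>
     (\<forall>p p' N n. (\<forall>i<N. p i = p' i) \<longrightarrow> A p N n = A p' N n) \<and>
     (\<forall>p N M n v. A p N n = Some v \<longrightarrow> N \<le> M \<longrightarrow> A p M n = Some v) \<and>
     (\<forall>p n v. \<Phi> p n = Some v \<longleftrightarrow> (\<exists>N. A p N n = Some v))"

lemma approximatesD:
  assumes "approximates A \<Phi>"
  shows "total_rec (\<lambda>p m. option_code (A p (pfst m) (psnd m)))"
    and "(\<And>i. i < N \<Longrightarrow> p i = p' i) \<Longrightarrow> A p N n = A p' N n"
    and "A p N n = Some v \<Longrightarrow> N \<le> M \<Longrightarrow> A p M n = Some v"
    and "\<Phi> p n = Some v \<longleftrightarrow> (\<exists>N. A p N n = Some v)"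
  using assms unfolding approximates_def by blast+

lemma approximates_total:
  assumes "total_rec (\<lambda>p. f)"
  shows "approximates (\<lambda>p N n. Some (f n)) (\<lambda>p n. Some (f n))"
proof -
  have "total_rec (\<lambda>p m. Suc (f (psnd m)))"
    by (intro total_rec_intros total_rec_comp[OF assms])
  then show ?thesis by (simp add: approximates_def)
qed

lemma prim_rec_mono:
  assumes "\<And>n v. g n = Some v \<Longrightarrow> g' n = Some v" "\<And>n v. h n = Some v \<Longrightarrow> h' n = Some v"
    and "prim_rec g h a k = Some v"
  shows "prim_rec g' h' a k = Some v"
  using assms(3) by (induction k arbitrary: v) (auto simp: bind_eq_Some_conv intro: assms)

text \<open>In this form the result depends on finitely many values of \<open>h\<close> and persists
  when \<open>h\<close> becomes more defined, which is what approximation by stages needs.\<close>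

lemma minimize_eq_Some_iff:
  "minimize h = Some k \<longleftrightarrow> h k = Some 0 \<and> (\<forall>j<k. \<exists>v. h j = Some (Suc v))"
proof
  assume "minimize h = Some k"
  then obtain l where l: "h l = Some 0" "\<forall>j<l. h j \<noteq> None" and k: "k = (LEAST k. h k = Some 0)"
    by (auto simp: minimize_def split: if_splits)
  have "h k = Some 0" "k \<le> l" unfolding k by (rule LeastI Least_le, rule l)+
  moreover have "h j \<noteq> Some 0" if "j < k" for j using that not_less_Least unfolding k by blast
  ultimately show "h k = Some 0 \<and> (\<forall>j<k. \<exists>v. h j = Some (Suc v))"
    using l(2) by (metis less_le_trans not0_implies_Suc option.exhaust)
next
  assume k: "h k = Some 0 \<and> (\<forall>j<k. \<exists>v. h j = Some (Suc v))"
  then have "(LEAST k. h k = Some 0) = k"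
    by (intro Least_equality) (auto simp: not_less[symmetric])
  moreover have "\<exists>k. h k = Some 0 \<and> (\<forall>j<k. h j \<noteq> None)"
    using k by (intro exI[of _ k]) auto
  ultimately show "minimize h = Some k" unfolding minimize_def by simp
qed

definition bounded_minimize :: "nat \<Rightarrow> (nat \<Rightarrow> nat option) \<Rightarrow> nat option" where
  "bounded_minimize N h = Option.bind (minimize h) (\<lambda>k. if k < N then Some k else None)"

lemma bounded_minimize_eq_Some_iff:
  "bounded_minimize N h = Some k \<longleftrightarrow> k < N \<and> h k = Some 0 \<and> (\<forall>j<k. \<exists>v. h j = Some (Suc v))"
  by (auto simp: bounded_minimize_def bind_eq_Some_conv minimize_eq_Some_iff split: if_splits)

text \<open>At most one \<open>k\<close> passes the test, so a recursion that keeps the last success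
  finds the first one.\<close>

lemma option_code_bounded_minimize:
  "option_code (bounded_minimize N h) =
     rec_nat 0 (\<lambda>k r. if option_code (h k) = 1 \<and> (\<forall>j<k. 2 \<le> option_code (h j)) then Suc k else r) N"
  (is "_ = ?s N")
proof -
  have code: "2 \<le> option_code v \<longleftrightarrow> (\<exists>k. v = Some (Suc k))" for v
    by (cases v) (auto simp: Suc_le_eq gr0_conv_Suc numeral_2_eq_2)
  have good: "option_code (h k) = 1 \<and> (\<forall>j<k. 2 \<le> option_code (h j)) \<longleftrightarrow> minimize h = Some k" for k
    by (simp add: minimize_eq_Some_iff code)
  have iff: "?s N = Suc k \<longleftrightarrow> k < N \<and> minimize h = Some k" for k
    unfolding good by (induction N) (auto simp: less_Suc_eq)
  have eqI: "a = b" if "\<And>k. a = Suc k \<longleftrightarrow> b = Suc k" for a b :: nat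
    using that[of "a - 1"] that[of "b - 1"] by (cases a; cases b) auto
  show ?thesis
    by (rule eqI) (simp only: iff option_code_simps bounded_minimize_eq_Some_iff minimize_eq_Some_iff)
qed

text \<open>A convergent computation reads finitely many oracle digits and makes finite searches, so
  some stage captures it. By monotonicity the maximum of the stages of several subcomputations
  serves all of them.\<close>

lemma approximation:
  assumes "recursive_functional \<Phi>"
  shows "\<exists>A. approximates A \<Phi>"
  using assms
proof induction
  case query
  have "total_rec (\<lambda>p m. if psnd m < pfst m then Suc (p (psnd m)) else 0)"
    by (intro total_rec_intros)
  moreover have "option_code (if c then Some k else None) = (if c then Suc k else 0)" for c k
    by simp
  ultimately have "approximates (\<lambda>p N n. if n < N then Some (p n) else None) (\<lambda>p n. Some (p n))"
    unfolding approximates_def by auto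
  then show ?case by blast
next
  case zero
  show ?case using approximates_total[OF total_rec_const] by blast
next
  case succ
  show ?case using approximates_total[OF total_rec_Suc[OF total_rec_id]] by blast
next
  case fst
  show ?case using approximates_total[OF total_rec_pfst[OF total_rec_id]] by (auto simp: pfst_def)
next
  case snd
  show ?case using approximates_total[OF total_rec_psnd[OF total_rec_id]] by (auto simp: psnd_def)
next
  case (pair F G)
  then obtain A B where A: "approximates A F" and B: "approximates B G" by blast
  let ?C = "\<lambda>p N n. Option.bind (A p N n) (\<lambda>a. Option.bind (B p N n) (\<lambda>b. Some \<langle>a, b\<rangle>))"
  have "option_code (Option.bind u (\<lambda>a. Option.bind w (\<lambda>b. Some \<langle>a, b\<rangle>))) =
      (if option_code u = 0 then 0 else if option_code w = 0 then 0
       else Suc \<langle>option_code u - 1, option_code w - 1\<rangle>)" for u w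
    by (cases u; cases w) auto
  then have "total_rec (\<lambda>p m. option_code (?C p (pfst m) (psnd m)))"
    by (simp only:) (intro total_rec_intros approximatesD(1)[OF A] approximatesD(1)[OF B])
  moreover have "?C p N n = ?C p' N n" if "\<And>i. i < N \<Longrightarrow> p i = p' i" for p p' N n
    using approximatesD(2)[OF A that] approximatesD(2)[OF B that] by simp
  moreover have mono: "?C p M n = Some v" if "?C p N n = Some v" "N \<le> M" for p N M n v
    using that by (auto simp: bind_eq_Some_conv dest: approximatesD(3)[OF A] approximatesD(3)[OF B])
  moreover have "Option.bind (F p n) (\<lambda>a. Option.bind (G p n) (\<lambda>b. Some \<langle>a, b\<rangle>)) = Some v \<longleftrightarrow>
      (\<exists>N. ?C p N n = Some v)" for p n v
  proof
    assume "Option.bind (F p n) (\<lambda>a. Option.bind (G p n) (\<lambda>b. Some \<langle>a, b\<rangle>)) = Some v"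
    then obtain a b N M where v: "v = \<langle>a, b\<rangle>" and "A p N n = Some a" "B p M n = Some b"
      by (auto simp: bind_eq_Some_conv approximatesD(4)[OF A] approximatesD(4)[OF B])
    then have "A p (max N M) n = Some a" "B p (max N M) n = Some b"
      using approximatesD(3)[OF A] approximatesD(3)[OF B] by (meson max.cobounded1 max.cobounded2)+
    with v show "\<exists>N. ?C p N n = Some v" by (intro exI[of _ "max N M"]) simp
  qed (auto simp: bind_eq_Some_conv approximatesD(4)[OF A] approximatesD(4)[OF B])
  ultimately have "approximates ?C (\<lambda>p n. Option.bind (F p n) (\<lambda>a. Option.bind (G p n) (\<lambda>b. Some \<langle>a, b\<rangle>)))"
    unfolding approximates_def by blast
  then show ?case by blast
next
  case (comp F G)
  then obtain A B where A: "approximates A F" and B: "approximates B G" by blast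
  let ?C = "\<lambda>p N n. Option.bind (B p N n) (A p N)"
  have "option_code (Option.bind w f) =
      (if option_code w = 0 then 0 else option_code (f (option_code w - 1)))" for w f
    by (cases w) auto
  then have "total_rec (\<lambda>p m. option_code (?C p (pfst m) (psnd m)))"
    by (simp only:) (intro total_rec_intros total_rec_comp2[OF approximatesD(1)[OF A]] approximatesD(1)[OF B])
  moreover have "?C p N n = ?C p' N n" if "\<And>i. i < N \<Longrightarrow> p i = p' i" for p p' N n
  proof -
    have "A p N = A p' N" "B p N = B p' N"
      using approximatesD(2)[OF A that] approximatesD(2)[OF B that] by auto
    then show ?thesis by simp
  qed
  moreover have mono: "?C p M n = Some v" if "?C p N n = Some v" "N \<le> M" for p N M n v
    using that by (auto simp: bind_eq_Some_conv dest: approximatesD(3)[OF A] approximatesD(3)[OF B])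
  moreover have "Option.bind (G p n) (F p) = Some v \<longleftrightarrow> (\<exists>N. ?C p N n = Some v)" for p n v
  proof
    assume "Option.bind (G p n) (F p) = Some v"
    then obtain b N M where "A p N b = Some v" "B p M n = Some b"
      by (auto simp: bind_eq_Some_conv approximatesD(4)[OF A] approximatesD(4)[OF B])
    then have "A p (max N M) b = Some v" "B p (max N M) n = Some b"
      using approximatesD(3)[OF A] approximatesD(3)[OF B] by (meson max.cobounded1 max.cobounded2)+
    then show "\<exists>N. ?C p N n = Some v" by (intro exI[of _ "max N M"]) simp
  qed (auto simp: bind_eq_Some_conv approximatesD(4)[OF A] approximatesD(4)[OF B])
  ultimately have "approximates ?C (\<lambda>p n. Option.bind (G p n) (F p))"
    unfolding approximates_def by blast
  then show ?case by blast
next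
  case (prec F G)
  then obtain A B where A: "approximates A F" and B: "approximates B G" by blast
  let ?C = "\<lambda>p N n. prim_rec (A p N) (B p N) (pfst n) (psnd n)"
  have "option_code (prim_rec g h a k) = rec_nat (option_code (g a))
      (\<lambda>k r. if r = 0 then 0 else option_code (h \<langle>a, \<langle>k, r - 1\<rangle>\<rangle>)) k" for g h a k
  proof (induction k)
    case (Suc k)
    then show ?case by (cases "prim_rec g h a k") (auto simp flip: Suc)
  qed simp
  then have "total_rec (\<lambda>p m. option_code (?C p (pfst m) (psnd m)))"
    by (simp only:) (intro total_rec_intros total_rec_comp2[OF approximatesD(1)[OF A]]
      total_rec_comp2[OF approximatesD(1)[OF B]])
  moreover have "?C p N n = ?C p' N n" if "\<And>i. i < N \<Longrightarrow> p i = p' i" for p p' N n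
  proof -
    have "A p N = A p' N" "B p N = B p' N"
      using approximatesD(2)[OF A that] approximatesD(2)[OF B that] by auto
    then show ?thesis by simp
  qed
  moreover have mono: "?C p M n = Some v" if "?C p N n = Some v" "N \<le> M" for p N M n v
    using prim_rec_mono[OF _ _ that(1)] approximatesD(3)[OF A] approximatesD(3)[OF B] that(2)
    by blast
  moreover have "prim_rec (F p) (G p) (pfst n) (psnd n) = Some v \<longleftrightarrow> (\<exists>N. ?C p N n = Some v)" for p n v
  proof
    assume "prim_rec (F p) (G p) (pfst n) (psnd n) = Some v"
    moreover have "\<exists>N. prim_rec (A p N) (B p N) a k = Some v"
      if "prim_rec (F p) (G p) a k = Some v" for a k
      using that
    proof (induction k arbitrary: v)
      case 0
      then show ?case by (simp add: approximatesD(4)[OF A])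
    next
      case (Suc k)
      then obtain r where r: "prim_rec (F p) (G p) a k = Some r" "G p \<langle>a, \<langle>k, r\<rangle>\<rangle> = Some v"
        by (auto simp: bind_eq_Some_conv)
      then obtain N M where N: "prim_rec (A p N) (B p N) a k = Some r"
        and M: "B p M \<langle>a, \<langle>k, r\<rangle>\<rangle> = Some v"
        using Suc.IH approximatesD(4)[OF B] by blast
      have "prim_rec (A p (max N M)) (B p (max N M)) a k = Some r"
        using mono[of p N "\<langle>a, k\<rangle>" r "max N M"] N unfolding pfst_pair psnd_pair
        by (meson max.cobounded1)
      moreover have "B p (max N M) \<langle>a, \<langle>k, r\<rangle>\<rangle> = Some v"
        using approximatesD(3)[OF B] M by (meson max.cobounded2)
      ultimately show ?case by (intro exI[of _ "max N M"]) simp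
    qed
    ultimately show "\<exists>N. ?C p N n = Some v" by blast
  next
    assume "\<exists>N. ?C p N n = Some v"
    then obtain N where N: "?C p N n = Some v" by blast
    show "prim_rec (F p) (G p) (pfst n) (psnd n) = Some v"
      by (rule prim_rec_mono[OF _ _ N]) (auto simp: approximatesD(4)[OF A] approximatesD(4)[OF B])
  qed
  ultimately have "approximates ?C (\<lambda>p n. prim_rec (F p) (G p) (pfst n) (psnd n))"
    unfolding approximates_def by blast
  then show ?case unfolding pfst_def psnd_def by blast
next
  case (mu F)
  then obtain A where A: "approximates A F" by blast
  let ?C = "\<lambda>p N n. bounded_minimize N (\<lambda>k. A p N \<langle>n, k\<rangle>)"
  have "total_rec (\<lambda>p m. option_code (?C p (pfst m) (psnd m)))"
    unfolding option_code_bounded_minimize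
    by (intro total_rec_intros total_rec_comp2[OF approximatesD(1)[OF A]])
  moreover have "?C p N n = ?C p' N n" if "\<And>i. i < N \<Longrightarrow> p i = p' i" for p p' N n
    using approximatesD(2)[OF A that] by simp
  moreover have mono: "?C p M n = Some v" if "?C p N n = Some v" "N \<le> M" for p N M n v
    using that approximatesD(3)[OF A _ that(2)] less_le_trans[OF _ that(2)]
    unfolding bounded_minimize_eq_Some_iff by blast
  moreover have "minimize (\<lambda>k. F p \<langle>n, k\<rangle>) = Some v \<longleftrightarrow> (\<exists>N. ?C p N n = Some v)" for p n v
  proof
    assume v: "minimize (\<lambda>k. F p \<langle>n, k\<rangle>) = Some v"
    have "\<exists>N. \<forall>M\<ge>N. A p M \<langle>n, k\<rangle> = F p \<langle>n, k\<rangle>" if "k \<le> v" for k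
    proof -
      have "F p \<langle>n, k\<rangle> \<noteq> None"
        using v le_imp_less_or_eq[OF that] by (auto simp: minimize_eq_Some_iff)
      then show ?thesis using approximatesD(3,4)[OF A] by (metis not_None_eq)
    qed
    then obtain N where N: "\<And>k M. k \<le> v \<Longrightarrow> N k \<le> M \<Longrightarrow> A p M \<langle>n, k\<rangle> = F p \<langle>n, k\<rangle>"
      by metis
    \<comment> \<open>\<open>Suc v\<close> places \<open>v\<close> below the search bound; the other
      elements settle all tests up to \<open>v\<close>.\<close>
    define M where "M = Max (insert (Suc v) (N ` {..v}))"
    have "v < M" unfolding M_def by (rule Suc_le_lessD, rule Max_ge) auto
    moreover have "A p M \<langle>n, k\<rangle> = F p \<langle>n, k\<rangle>" if "k \<le> v" for k
      by (rule N[OF that]) (unfold M_def, rule Max_ge, use that in auto)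
    ultimately have "?C p M n = Some v"
      using v unfolding bounded_minimize_eq_Some_iff minimize_eq_Some_iff by simp
    then show "\<exists>N. ?C p N n = Some v" by blast
  next
    assume "\<exists>N. ?C p N n = Some v"
    then show "minimize (\<lambda>k. F p \<langle>n, k\<rangle>) = Some v"
      unfolding bounded_minimize_eq_Some_iff minimize_eq_Some_iff
      using approximatesD(4)[OF A] by blast
  qed
  ultimately have "approximates ?C (\<lambda>p n. minimize (\<lambda>k. F p \<langle>n, k\<rangle>))"
    unfolding approximates_def by blast
  then show ?case by blast
qed

text \<open>\<open>D a x N\<close> means that no condition with index below \<open>N\<close> has
  been refuted by stage \<open>N\<close>. It sees only the first \<open>N\<close> digits of
  \<open>x\<close>, so it is a condition on a finite prefix and can define a tree.\<close>

lemma pi01_approximation: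
  assumes "decidable2 P"
  obtains D where "decidable2 D"
    and "\<And>a x y N. (\<And>i. i < N \<Longrightarrow> x i = y i) \<Longrightarrow> D a x N \<Longrightarrow> D a y N"
    and "\<And>a x N M. D a x M \<Longrightarrow> N \<le> M \<Longrightarrow> D a x N"
    and "\<And>a x. (\<forall>N. D a x N) \<longleftrightarrow> (\<forall>k. P a x k)"
proof -
  obtain A where A: "approximates A
      (\<lambda>q k. Some (of_bool (P (\<lambda>i. q (2 * i)) (\<lambda>i. q (Suc (2 * i))) k)))"
    using approximation assms[unfolded total_rec_def] by blast
  \<comment> \<open>Code 1 stands for \<open>Some 0\<close>, a refutation; a value that is still
    undefined does not reject.\<close>
  define D where "D = (\<lambda>a x N. \<forall>k<N. option_code (A (baire_pair a x) N k) \<noteq> 1)"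
  have D: "D a x N \<longleftrightarrow> (\<forall>k<N. A (baire_pair a x) N k \<noteq> Some 0)" for a x N
    by (simp add: D_def)
  have pair: "baire_pair (\<lambda>i. q (2 * i)) (\<lambda>i. q (Suc (2 * i))) = q" for q
    by (rule ext) (auto simp: baire_pair_def elim: evenE oddE)
  have lim: "P a x k \<longleftrightarrow> (\<forall>N. A (baire_pair a x) N k \<noteq> Some 0)" for a x k
    using approximatesD(4)[OF A, of "baire_pair a x" k 0] by (auto simp: baire_pair_def)
  show ?thesis
  proof
    show "decidable2 D"
      unfolding D_def pair
      by (intro total_rec_intros total_rec_comp2[OF approximatesD(1)[OF A]])
    show "D a y N" if "\<And>i. i < N \<Longrightarrow> x i = y i" "D a x N" for a x y N
    proof -
      have "A (baire_pair a x) N k = A (baire_pair a y) N k" for k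
        by (rule approximatesD(2)[OF A]) (auto simp: baire_pair_def intro: that(1))
      with that(2) show ?thesis by (simp add: D)
    qed
    show "D a x N" if "D a x M" "N \<le> M" for a x N M
      using that approximatesD(3)[OF A] unfolding D by (meson less_le_trans)
    show "(\<forall>N. D a x N) \<longleftrightarrow> (\<forall>k. P a x k)" for a x
    proof
      assume all: "\<forall>N. D a x N"
      show "\<forall>k. P a x k"
        unfolding lim
      proof (intro allI notI)
        fix k N
        assume "A (baire_pair a x) N k = Some 0"
        \<comment> \<open>The stage has to exceed \<open>k\<close> as well, because stage
          \<open>N\<close> inspects only indices below \<open>N\<close>.\<close>
        then have "A (baire_pair a x) (max N (Suc k)) k = Some 0"
          using approximatesD(3)[OF A] by (meson max.cobounded1)
        moreover have "k < max N (Suc k)" by simp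
        ultimately show False using all unfolding D by blast
      qed
    qed (simp add: lim D)
  qed
qed

lemma list_nth_encode: "i < length w \<Longrightarrow> list_nth (list_encode w) i = w ! i"
  and list_len_encode [simp]: "list_len (list_encode w) = length w"
  by (simp_all add: list_nth_def list_len_def)

text \<open>The tree consists of the sequences that pass the stage given by their length. Locality
  makes the zeros that \<open>list_nth\<close> appends harmless, and antimonotonicity gives closure
  under prefixes.\<close>

lemma pi01_closed_name:
  assumes "decidable2 P"
  obtains e where "total_rec e" and "\<And>a. closed_rep (e a) = Some {x. \<forall>k. P a x k}"
proof -
  obtain D where D: "decidable2 D"
    and local: "\<And>a x y N. (\<And>i. i < N \<Longrightarrow> x i = y i) \<Longrightarrow> D a x N \<Longrightarrow> D a y N"
    and antimono: "\<And>a x N M. D a x M \<Longrightarrow> N \<le> M \<Longrightarrow> D a x N"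
    and lim: "\<And>a x. (\<forall>N. D a x N) \<longleftrightarrow> (\<forall>k. P a x k)"
    using pi01_approximation[OF assms] by blast
  define e where "e = (\<lambda>a c. of_bool (D a (\<lambda>i. list_nth c i) (list_len c)) :: nat)"
  have mem: "w \<in> coded_set (e a) \<longleftrightarrow> D a (list_nth (list_encode w)) (length w)" for a w
    by (simp add: coded_set_def e_def)
  have "is_tree (coded_set (e a))" for a
    unfolding is_tree_def
  proof (intro ballI allI impI)
    fix w v
    assume w: "w \<in> coded_set (e a)" and v: "prefix v w"
    have "D a (list_nth (list_encode w)) (length v)"
      using w[unfolded mem] prefix_length_le[OF v] by (rule antimono)
    then have "D a (list_nth (list_encode v)) (length v)"
      using v by (elim local[rotated]) (auto simp: list_nth_encode prefix_def nth_append)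
    then show "v \<in> coded_set (e a)" by (simp add: mem)
  qed
  moreover have "paths (coded_set (e a)) = {x. \<forall>k. P a x k}" for a
  proof -
    have "map x [0..<N] \<in> coded_set (e a) \<longleftrightarrow> D a x N" for x N
      unfolding mem by (auto elim!: local[rotated] simp: list_nth_encode)
    then show ?thesis by (simp add: paths_def flip: lim)
  qed
  ultimately have "closed_rep (e a) = Some {x. \<forall>k. P a x k}" for a
    by (auto simp: closed_rep_def) (auto simp: e_def)
  moreover have "total_rec e"
    unfolding e_def by (intro total_rec2_substitution[OF D] total_rec_intros)
  ultimately show ?thesis using that by blast
qed

section \<open>The game selecting a unique value\<close>

text \<open>The value is \<open>0\<close> if the player to move loses and \<open>Suc j\<close> if \<open>j\<close> is the least winning move.
  Outside of \<open>W\<close> the value is \<open>1\<close> because a player who leaves \<open>W\<close> loses.\<close>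

definition least_winning_moves :: "(nat list \<Rightarrow> bool) \<Rightarrow> (nat list \<Rightarrow> nat) \<Rightarrow> bool" where
  "least_winning_moves W u \<longleftrightarrow>
     (\<forall>w. u w = (if \<not> W w then 1
                 else if \<exists>j. u (w @ [j]) = 0 then Suc (LEAST j. u (w @ [j]) = 0) else 0))"

lemma least_winning_movesD:
  assumes "least_winning_moves W u"
  shows "u w = (if \<not> W w then 1
                 else if \<exists>j. u (w @ [j]) = 0 then Suc (LEAST j. u (w @ [j]) = 0) else 0)"
  using assms unfolding least_winning_moves_def by blast

text \<open>Eliminates the existential quantifier and the least number in favour of universal
  conditions, each inspecting \<open>u\<close> only at \<open>w\<close> and one child. Hence the
  solutions \<open>u\<close> form an effectively closed set when \<open>W\<close> is
  decidable.\<close>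

lemma least_winning_moves_iff:
  "least_winning_moves W u \<longleftrightarrow>
     (\<forall>w. (\<not> W w \<longrightarrow> u w = 1) \<and> (W w \<longrightarrow>
       (\<forall>j. (u w = Suc j \<longrightarrow> u (w @ [j]) = 0) \<and> (u (w @ [j]) = 0 \<longrightarrow> 0 < u w \<and> u w \<le> Suc j))))"
proof -
  have "v = (if \<exists>j. Z j then Suc (LEAST j. Z j) else 0) \<longleftrightarrow>
      (\<forall>j. (v = Suc j \<longrightarrow> Z j) \<and> (Z j \<longrightarrow> 0 < v \<and> v \<le> Suc j))" (is "?l \<longleftrightarrow> ?r") for v :: nat and Z
  proof
    assume ?l
    then show ?r by (auto intro: LeastI Least_le)
  next
    assume r: ?r
    show ?l
    proof (cases v)
      case 0
      with r show ?thesis by auto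
    next
      case (Suc j)
      with r have "Z j" "\<And>i. Z i \<Longrightarrow> j \<le> i" by auto
      then have "(LEAST j. Z j) = j" by (rule Least_equality)
      with Suc \<open>Z j\<close> show ?thesis by auto
    qed
  qed
  then show ?thesis unfolding least_winning_moves_def by (intro iff_allI) simp
qed

section \<open>Well-founded games and their solutions\<close>

definition extensions :: "(nat list \<Rightarrow> bool) \<Rightarrow> (nat list \<times> nat list) set" where
  "extensions W = {(w @ [j], w) | w j. W w}"

text \<open>Each step of a descending chain appends one digit, so the chain converges to a sequence
  all of whose prefixes satisfy \<open>W\<close>.\<close>

lemma wf_extensions:
  assumes closed: "\<And>v w. W (v @ w) \<Longrightarrow> W v" and wf: "\<And>x. \<exists>N. \<not> W (map x [0..<N])"
  shows "wf (extensions W)"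
  unfolding wf_iff_no_infinite_down_chain
proof
  assume "\<exists>f. \<forall>i. (f (Suc i), f i) \<in> extensions W"
  then obtain f where f: "\<And>i. (f (Suc i), f i) \<in> extensions W" by blast
  have W: "W (f i)" for i using f[of i] by (auto simp: extensions_def)
  have len: "length (f i) = length (f 0) + i" for i
    by (induction i) (use f in \<open>auto simp: extensions_def\<close>, metis append_eq_conv_conj length_append_singleton)
  have nth: "f N ! k = f (Suc k) ! k" if "k < N" for k N
    using that
  proof (induction N)
    case (Suc N)
    obtain j where "f (Suc N) = f N @ [j]" using f[of N] by (auto simp: extensions_def)
    then show ?case using Suc len[of N] by (cases "k = N") (auto simp: nth_append)
  qed simp
  \<comment> \<open>The chain may start at a nonempty list, so \<open>f N\<close> can be longer than
    \<open>N\<close>; digit \<open>k\<close> is taken from \<open>f (Suc k)\<close>, which is long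
    enough.\<close>
  define x where "x = (\<lambda>k. f (Suc k) ! k)"
  have "map x [0..<N] = take N (f N)" for N
  proof (rule nth_equalityI)
    show "map x [0..<N] ! k = take N (f N) ! k" if "k < length (map x [0..<N])" for k
      using that nth[of k N] by (simp add: x_def)
  qed (simp add: len[of N])
  then have "W (map x [0..<N])" for N
    using closed[of "take N (f N)" "drop N (f N)"] W[of N] by simp
  with wf show False by blast
qed

text \<open>Well-founded recursion applies because the value at \<open>w\<close> consults children
  only if \<open>W w\<close>, and these are exactly the pairs in
  \<open>extensions W\<close>.\<close>

lemma ex_least_winning_moves:
  assumes "wf (extensions W)"
  shows "\<exists>u. least_winning_moves W u"
proof -
  define F :: "(nat list \<Rightarrow> nat) \<Rightarrow> nat list \<Rightarrow> nat" where "F = (\<lambda>u w. if \<not> W w then 1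
     else if \<exists>j. u (w @ [j]) = 0 then Suc (LEAST j. u (w @ [j]) = 0) else 0)"
  have "F (cut u (extensions W) w) w = F u w" for u w
    by (cases "W w") (simp_all add: F_def cut_def extensions_def)
  then have "wfrec (extensions W) F w = F (wfrec (extensions W) F) w" for w
    using wfrec[OF assms, of F w] by simp
  then show ?thesis unfolding least_winning_moves_def F_def by blast
qed

lemma least_winning_moves_unique:
  assumes "wf (extensions W)" and u: "least_winning_moves W u" and v: "least_winning_moves W v"
  shows "u = v"
proof
  show "u w = v w" for w
    using assms(1)
  proof (induction w rule: wf_induct_rule)
    case (less w)
    show ?case
    proof (cases "W w")
      case True
      then have eq: "u (w @ [j]) = v (w @ [j])" for j
        by (intro less) (auto simp: extensions_def)
      show ?thesis
        by (subst least_winning_movesD[OF u], subst least_winning_movesD[OF v]) (simp only: eq)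
    qed (simp add: least_winning_movesD[OF u, of w] least_winning_movesD[OF v, of w])
  qed
qed

text \<open>\<open>Q\<close> describes a strategy of the player not to move: every legal move from
  \<open>Q\<close> has a reply back into \<open>Q\<close>. The induction goes down two moves at a
  time, hence along the transitive closure.\<close>

lemma strategy_losing_positions:
  assumes wf: "wf (extensions W)" and u: "least_winning_moves W u"
    and Q: "\<And>w. w \<in> Q \<Longrightarrow> W w"
    and reply: "\<And>w j. w \<in> Q \<Longrightarrow> W (w @ [j]) \<Longrightarrow> \<exists>i. w @ [j, i] \<in> Q"
    and "w \<in> Q"
  shows "u w = 0"
  using wf_trancl[OF wf] \<open>w \<in> Q\<close>
proof (induction w rule: wf_induct_rule)
  case (less w)
  show ?case
  proof (rule ccontr)
    assume "u w \<noteq> 0"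
    then obtain j where j: "u (w @ [j]) = 0"
      using Q[OF \<open>w \<in> Q\<close>] least_winning_movesD[OF u, of w] by (auto split: if_splits)
    \<comment> \<open>Positions outside \<open>W\<close> have value 1, so a child of value 0 is
      legal.\<close>
    then have W: "W (w @ [j])"
      using least_winning_movesD[OF u, of "w @ [j]"] by (auto split: if_splits)
    then obtain i where i: "w @ [j, i] \<in> Q" using reply \<open>w \<in> Q\<close> by blast
    have "(w @ [j], w) \<in> extensions W" "((w @ [j]) @ [i], w @ [j]) \<in> extensions W"
      using Q[OF \<open>w \<in> Q\<close>] W unfolding extensions_def by blast+
    then have "((w @ [j]) @ [i], w) \<in> (extensions W)\<^sup>+" by (meson r_into_trancl trancl_trans)
    then have "u ((w @ [j]) @ [i]) = 0" using less.IH i by simp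
    then have "\<exists>i. u ((w @ [j]) @ [i]) = 0" by blast
    then show False
      using j W least_winning_movesD[OF u, of "w @ [j]"] by (simp del: append_assoc)
  qed
qed

section \<open>The game between two paths\<close>

text \<open>A position is a list \<open>[n, m, b\<^sub>0, a\<^sub>0, b\<^sub>1, a\<^sub>1, \<dots>]\<close>, where the path \<open>a\<close> of \<open>D\<close> has to take the
  value \<open>m\<close> at \<open>\<langle>0, n\<rangle>\<close> and the path \<open>b\<close> another one.  The list is given as the first \<open>L\<close> values
  of \<open>v\<close>, and truncated subtraction makes both digit counts \<open>0\<close> for \<open>L \<le> 2\<close>.\<close>

definition legal :: "(baire \<Rightarrow> nat \<Rightarrow> bool) \<Rightarrow> baire \<Rightarrow> nat \<Rightarrow> bool" where
  "legal D v L \<longleftrightarrow>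
     D (\<lambda>i. v (2 * i + 2)) ((L - 1) div 2) \<and> D (\<lambda>i. v (2 * i + 3)) ((L - 2) div 2) \<and>
     (\<langle>0, v 0\<rangle> < (L - 1) div 2 \<longrightarrow> v (2 * \<langle>0, v 0\<rangle> + 2) \<noteq> v 1) \<and>
     (\<langle>0, v 0\<rangle> < (L - 2) div 2 \<longrightarrow> v (2 * \<langle>0, v 0\<rangle> + 3) = v 1)"

definition legal_position :: "(baire \<Rightarrow> nat \<Rightarrow> bool) \<Rightarrow> nat list \<Rightarrow> bool" where
  "legal_position D w \<longleftrightarrow> legal D (list_nth (list_encode w)) (length w)"

text \<open>The data are fixed here: \<open>z\<close> is one path of the tree, and all paths project
  to \<open>y\<close>. The winning player will simply copy \<open>z\<close>.\<close>

locale selection_game =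
  fixes D :: "baire \<Rightarrow> nat \<Rightarrow> bool" and y z :: baire
  assumes local: "\<And>x x' N. (\<And>i. i < N \<Longrightarrow> x i = x' i) \<Longrightarrow> D x N \<Longrightarrow> D x' N"
    and antimono: "\<And>x N M. D x M \<Longrightarrow> N \<le> M \<Longrightarrow> D x N"
    and path: "\<And>N. D z N"
    and unique: "\<And>x n. (\<And>N. D x N) \<Longrightarrow> x \<langle>0, n\<rangle> = y n"
begin

lemma D_0: "D x 0"
  using local[OF _ path[of 0]] by simp

lemma legal_cong:
  assumes eq: "\<And>i. i < L \<Longrightarrow> v i = v' i" and v: "legal D v L"
  shows "legal D v' L"
proof -
  have "D (\<lambda>i. v' (2 * i + 2)) ((L - 1) div 2)" "D (\<lambda>i. v' (2 * i + 3)) ((L - 2) div 2)"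
    using v by (auto simp: legal_def intro!: eq elim!: local[rotated])
  \<comment> \<open>Once a value test applies, \<open>L\<close> is at least 3, so \<open>n\<close>
    and \<open>m\<close> are among the entries compared.\<close>
  moreover have "v 0 = v' 0 \<and> v 1 = v' 1" if "\<langle>0, n\<rangle> < (L - 1) div 2 \<or> \<langle>0, n\<rangle> < (L - 2) div 2" for n
    using that by (intro conjI eq) auto
  ultimately show ?thesis
    using v eq[of "2 * \<langle>0, v 0\<rangle> + 2"] eq[of "2 * \<langle>0, v 0\<rangle> + 3"] unfolding legal_def
    by fastforce
qed

lemma legal_antimono:
  assumes v: "legal D v M" and "L \<le> M"
  shows "legal D v L"
proof -
  have "(L - 1) div 2 \<le> (M - 1) div 2" "(L - 2) div 2 \<le> (M - 2) div 2"
    using \<open>L \<le> M\<close> by (simp_all add: div_le_mono)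
  with v show ?thesis unfolding legal_def by (meson antimono less_le_trans)
qed

lemma legal_position_iff:
  assumes "\<And>i. i < length w \<Longrightarrow> w ! i = v i"
  shows "legal_position D w \<longleftrightarrow> legal D v (length w)"
  unfolding legal_position_def
  by (auto elim!: legal_cong[rotated] simp: list_nth_encode assms)

text \<open>An infinite legal play would contain two paths of \<open>D\<close>. Both project to
  \<open>y\<close>, yet exactly one of them takes the value \<open>m\<close> at
  \<open>n\<close>.\<close>

lemma wf_game: "wf (extensions (legal_position D))"
proof (rule wf_extensions)
  show "legal_position D v" if "legal_position D (v @ w)" for v w
  proof -
    have "legal D (list_nth (list_encode (v @ w))) (length v)"
      using that unfolding legal_position_def by (rule legal_antimono) simp
    then show ?thesis
      by (subst legal_position_iff) (auto simp: list_nth_encode nth_append)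
  qed
  show "\<exists>N. \<not> legal_position D (map x [0..<N])" for x
  proof (rule ccontr)
    assume "\<not> ?thesis"
    moreover have "legal_position D (map x [0..<N]) \<longleftrightarrow> legal D x N" for N
      by (subst legal_position_iff) auto
    ultimately have x: "legal D x N" for N by blast
    have "D (\<lambda>i. x (2 * i + 2)) N" "D (\<lambda>i. x (2 * i + 3)) N" for N
      using x[of "2 * N + 1"] x[of "2 * N + 2"] by (simp_all add: legal_def)
    then have "x (2 * \<langle>0, x 0\<rangle> + 2) = y (x 0)" "x (2 * \<langle>0, x 0\<rangle> + 3) = y (x 0)"
      using unique[of "\<lambda>i. x (2 * i + 2)"] unique[of "\<lambda>i. x (2 * i + 3)"] by simp_all
    \<comment> \<open>At this length both players have chosen the digit at
      \<open>\<langle>0, x 0\<rangle>\<close>, so both value tests apply.\<close>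
    with x[of "2 * Suc \<langle>0, x 0\<rangle> + 2"] show False by (simp add: legal_def)
  qed
qed

text \<open>The opponent \<open>b\<close> is to move, and player \<open>a\<close> answers with the
  digits of \<open>z\<close>, which takes the required value.\<close>

lemma right_value_losing:
  assumes u: "least_winning_moves (legal_position D) u"
  shows "u [n, y n] = 0"
proof (rule strategy_losing_positions[OF wf_game u])
  \<comment> \<open>These are the positions with \<open>b\<close> to move in which \<open>a\<close>
    has copied \<open>z\<close> so far.\<close>
  define Q where "Q = {w. legal_position D w \<and> even (length w) \<and> 2 \<le> length w \<and> w ! 1 = y (w ! 0) \<and>
      (\<forall>i. 2 * i + 3 < length w \<longrightarrow> w ! (2 * i + 3) = z i)}"
  show "[n, y n] \<in> Q"
    by (auto simp: Q_def legal_position_def legal_def D_0)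
  show "legal_position D w" if "w \<in> Q" for w using that by (simp add: Q_def)
  show "\<exists>i. w @ [j, i] \<in> Q" if w: "w \<in> Q" and j: "legal_position D (w @ [j])" for w j
  proof -
    obtain l where l: "length w = 2 * l + 2"
    proof -
      have "even (length w - 2)" "2 \<le> length w" using w by (auto simp: Q_def)
      then show ?thesis using that[of "(length w - 2) div 2"] by auto
    qed
    define w' where "w' = w @ [j, z l]"
    define v where "v = (\<lambda>i. w' ! i)"
    have v: "v (2 * i + 3) = z i" if "i \<le> l" for i
      using that w l by (cases "i = l") (auto simp: v_def w'_def Q_def nth_append Suc_diff_le)
    have v01: "v 1 = y (v 0)"
      using w l by (auto simp: v_def w'_def Q_def nth_append)
    have "legal_position D (w @ [j]) \<longleftrightarrow> legal D v (length (w @ [j]))"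
      by (rule legal_position_iff) (auto simp: v_def w'_def nth_append)
    moreover have "length (w @ [j]) = 2 * l + 3" using l by simp
    ultimately have "legal D v (2 * l + 3)" using j by metis
    moreover have "D (\<lambda>i. v (2 * i + 3)) (Suc l)"
      by (rule local[OF _ path], rule v[symmetric]) simp
    moreover have "v (2 * \<langle>0, v 0\<rangle> + 3) = v 1" if "\<langle>0, v 0\<rangle> < Suc l"
      using that v[of "\<langle>0, v 0\<rangle>"] v01 unique[OF path, of "v 0"] by simp
    ultimately have "legal D v (2 * l + 4)" by (simp add: legal_def)
    then have "legal_position D w'"
      using legal_position_iff[of w' v] l by (simp add: v_def w'_def eval_nat_numeral)
    then have "w' \<in> Q"
      using v v01 l by (auto simp: Q_def v_def w'_def)
    then show ?thesis unfolding w'_def by blast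
  qed
qed

text \<open>Player \<open>b\<close> opens with \<open>z 0\<close> and keeps copying
  \<open>z\<close>, whose value \<open>y n\<close> differs from \<open>m\<close>.\<close>

lemma wrong_value_winning:
  assumes u: "least_winning_moves (legal_position D) u" and "m \<noteq> y n"
  shows "u [n, m] \<noteq> 0"
proof -
  have "u [n, m, z 0] = 0"
  proof (rule strategy_losing_positions[OF wf_game u])
    define Q where "Q = {w. legal_position D w \<and> odd (length w) \<and> 3 \<le> length w \<and> w ! 1 \<noteq> y (w ! 0) \<and>
        (\<forall>i. 2 * i + 2 < length w \<longrightarrow> w ! (2 * i + 2) = z i)}"
    have "D (\<lambda>i. list_nth (list_encode [n, m, z 0]) (2 * i + 2)) 1"
      by (rule local[OF _ path]) (simp add: list_nth_encode del: list_encode.simps)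
    \<comment> \<open>In this case the opening digit is itself subject to the value test.\<close>
    moreover have "z 0 = y n" if "\<langle>0, n\<rangle> = 0"
      using unique[OF path, of n] that by simp
    ultimately have "legal_position D [n, m, z 0]"
      using \<open>m \<noteq> y n\<close> by (auto simp: legal_position_def legal_def D_0 list_nth_encode simp del: list_encode.simps)
    then show "[n, m, z 0] \<in> Q"
      using \<open>m \<noteq> y n\<close> by (auto simp: Q_def)
    show "legal_position D w" if "w \<in> Q" for w using that by (simp add: Q_def)
    show "\<exists>i. w @ [j, i] \<in> Q" if w: "w \<in> Q" and j: "legal_position D (w @ [j])" for w j
    proof -
      obtain l where l: "length w = 2 * l + 3"
      proof -
        have "even (length w - 3)" "3 \<le> length w" using w by (auto simp: Q_def)
        then show ?thesis using that[of "(length w - 3) div 2"] by auto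
      qed
      define w' where "w' = w @ [j, z (Suc l)]"
      define v where "v = (\<lambda>i. w' ! i)"
      have v: "v (2 * i + 2) = z i" if "i \<le> Suc l" for i
        using that w l by (cases "i = Suc l") (auto simp: v_def w'_def Q_def nth_append Suc_diff_le)
      have v01: "v 1 \<noteq> y (v 0)"
        using w l by (auto simp: v_def w'_def Q_def nth_append)
      have "legal_position D (w @ [j]) \<longleftrightarrow> legal D v (length (w @ [j]))"
        by (rule legal_position_iff) (auto simp: v_def w'_def nth_append)
      moreover have "length (w @ [j]) = 2 * l + 4" using l by simp
      ultimately have "legal D v (2 * l + 4)" using j by metis
      moreover have "D (\<lambda>i. v (2 * i + 2)) (Suc (Suc l))"
        by (rule local[OF _ path], rule v[symmetric]) simp
      moreover have "v (2 * \<langle>0, v 0\<rangle> + 2) \<noteq> v 1" if "\<langle>0, v 0\<rangle> < Suc (Suc l)"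
        using that v[of "\<langle>0, v 0\<rangle>"] v01 unique[OF path, of "v 0"] by simp
      ultimately have "legal D v (2 * l + 5)" by (simp add: legal_def)
      then have "legal_position D w'"
        using legal_position_iff[of w' v] l by (simp add: v_def w'_def eval_nat_numeral)
      then have "w' \<in> Q"
        using v v01 l by (auto simp: Q_def v_def w'_def)
      then show ?thesis unfolding w'_def by blast
    qed
  qed
  moreover have "legal_position D [n, m]"
    by (simp add: legal_position_def legal_def D_0)
  ultimately show ?thesis using least_winning_movesD[OF u, of "[n, m]"] by (auto split: if_splits)
qed

text \<open>The moves at \<open>[n]\<close> are the candidates \<open>m\<close>; the only one that
  leaves the next player losing is \<open>y n\<close>.\<close>

lemma value_from_moves:
  assumes u: "least_winning_moves (legal_position D) u"
  shows "u [n] = Suc (y n)"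
proof -
  have "u ([n] @ [m]) = 0 \<longleftrightarrow> m = y n" for m
    using right_value_losing[OF u, of n] wrong_value_winning[OF u, of m n]
    by (cases "m = y n") auto
  moreover have "(LEAST m. m = y n) = y n"
    by (rule Least_equality) auto
  moreover have "legal_position D [n]"
    by (simp add: legal_position_def legal_def D_0)
  ultimately show ?thesis
    using least_winning_movesD[OF u, of "[n]"] by simp
qed

end

text \<open>The solutions of the game form an effectively closed set uniformly in \<open>a\<close>.
  Under the assumptions on \<open>a\<close> the game is well-founded, so the solution is unique, and
  its entry at \<open>[n]\<close> reveals \<open>y n\<close>.\<close>

lemma singleton_value_name:
  assumes "decidable2 P"
  obtains e where "total_rec e"
    and "\<And>a y. \<exists>x. \<forall>k. P a x k \<Longrightarrow> (\<And>x n. \<forall>k. P a x k \<Longrightarrow> x \<langle>0, n\<rangle> = y n) \<Longrightarrow>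
           \<exists>u. closed_rep (e a) = Some {u} \<and> (\<forall>n. u (list_encode [n]) = Suc (y n))"
proof -
  obtain D where D: "decidable2 D"
    and local: "\<And>a x y N. (\<And>i. i < N \<Longrightarrow> x i = y i) \<Longrightarrow> D a x N \<Longrightarrow> D a y N"
    and antimono: "\<And>a x N M. D a x M \<Longrightarrow> N \<le> M \<Longrightarrow> D a x N"
    and lim: "\<And>a x. (\<forall>N. D a x N) \<longleftrightarrow> (\<forall>k. P a x k)"
    using pi01_approximation[OF assms] by blast
  define W where "W = (\<lambda>a c. legal (D a) (list_nth c) (list_len c))"
  have W_encode: "W a (list_encode w) \<longleftrightarrow> legal_position (D a) w" for a w
    by (simp add: W_def legal_position_def)
  \<comment> \<open>Comparing codes entrywise avoids a recursive function for appending; the move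
    \<open>j\<close> is then the last entry of the child.\<close>
  define child where "child = (\<lambda>c c'. list_len c' = Suc (list_len c) \<and> (\<forall>i<list_len c. list_nth c i = list_nth c' i))"
  define R where "R = (\<lambda>a u k.
      (\<not> W a (pfst k) \<longrightarrow> u (pfst k) = 1) \<and>
      (W a (pfst k) \<and> child (pfst k) (psnd k) \<longrightarrow>
        (u (pfst k) = Suc (list_nth (psnd k) (list_len (pfst k))) \<longrightarrow> u (psnd k) = (0::nat)) \<and>
        (u (psnd k) = 0 \<longrightarrow> 0 < u (pfst k) \<and> u (pfst k) \<le> Suc (list_nth (psnd k) (list_len (pfst k))))))"
  have "decidable2 (\<lambda>a u k. D a (\<lambda>i. list_nth (pfst k) (2 * i + 2)) ((list_len (pfst k) - 1) div 2))"
    "decidable2 (\<lambda>a u k. D a (\<lambda>i. list_nth (pfst k) (2 * i + 3)) ((list_len (pfst k) - 2) div 2))"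
    by (intro total_rec2_substitution[OF D] total_rec_intros)+
  then have "decidable2 R"
    unfolding R_def W_def child_def legal_def by (intro total_rec_intros)
  then obtain e where e: "total_rec e" and name: "\<And>a. closed_rep (e a) = Some {u. \<forall>k. R a u k}"
    using pi01_closed_name by blast
  have child: "child (list_encode w) c \<longleftrightarrow> (\<exists>j. c = list_encode (w @ [j]))" for w c
  proof
    assume c: "child (list_encode w) c"
    define w' where "w' = list_decode c"
    have "length w' = Suc (length w)" "\<And>i. i < length w \<Longrightarrow> w ! i = w' ! i"
      using c by (auto simp: child_def w'_def list_len_def list_nth_def)
    then have "w' = w @ [w' ! length w]"
      by (intro nth_equalityI) (auto simp: nth_append less_Suc_eq)
    then show "\<exists>j. c = list_encode (w @ [j])" by (metis list_decode_inverse w'_def)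
  qed (auto simp: child_def list_nth_encode nth_append)
  have R: "(\<forall>k. R a u k) \<longleftrightarrow> least_winning_moves (legal_position (D a)) (\<lambda>w. u (list_encode w))"
    (is "?l \<longleftrightarrow> ?r") for a u
  proof -
    have all_range: "(\<forall>c'. X \<and> (Y \<and> (\<exists>j. c' = f j) \<longrightarrow> Z c')) \<longleftrightarrow> X \<and> (Y \<longrightarrow> (\<forall>j. Z (f j)))"
      for X Y Z and f :: "nat \<Rightarrow> nat"
      by blast
    have "?l \<longleftrightarrow> (\<forall>c c'. R a u \<langle>c, c'\<rangle>)" by (metis pair_pfst_psnd)
    also have "\<dots> \<longleftrightarrow> (\<forall>w c'. R a u \<langle>list_encode w, c'\<rangle>)" by (metis list_decode_inverse)
    also have "\<dots> \<longleftrightarrow> ?r"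
      unfolding least_winning_moves_iff R_def pfst_pair psnd_pair child W_encode all_range
      by (simp add: list_nth_encode)
    finally show ?thesis .
  qed
  show ?thesis
  proof
    fix a y
    assume "\<exists>x. \<forall>k. P a x k" and unique: "\<And>x n. \<forall>k. P a x k \<Longrightarrow> x \<langle>0, n\<rangle> = y n"
    then obtain z where z: "\<forall>k. P a z k" by blast
    interpret selection_game "D a" y z
    proof
      show "D a z N" for N using z lim by blast
      show "x \<langle>0, n\<rangle> = y n" if "\<And>N. D a x N" for x n using that lim unique by blast
    qed (fact local antimono)+
    obtain u where u: "least_winning_moves (legal_position (D a)) u"
      using ex_least_winning_moves[OF wf_game] by blast
    have "(\<forall>k. R a v k) \<longleftrightarrow> v = (\<lambda>c. u (list_decode c))" for v
    proof
      assume "\<forall>k. R a v k"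
      then have "(\<lambda>w. v (list_encode w)) = u"
        unfolding R by (rule least_winning_moves_unique[OF wf_game _ u])
      from fun_cong[OF this, of "list_decode c" for c]
      show "v = (\<lambda>c. u (list_decode c))" by (simp add: fun_eq_iff)
    qed (use u in \<open>simp add: R\<close>)
    then have "closed_rep (e a) = Some {\<lambda>c. u (list_decode c)}"
      unfolding name by auto
    then show "\<exists>u. closed_rep (e a) = Some {u} \<and> (\<forall>n. u (list_encode [n]) = Suc (y n))"
      using value_from_moves[OF u] by (intro exI conjI) (auto simp del: list_encode.simps)
  qed (rule e)
qed

section \<open>Reductions\<close>

definition valid_instances :: "baire \<Rightarrow> bool" where
  "valid_instances h \<longleftrightarrow> (\<forall>i. closed_rep (\<lambda>n. h \<langle>i, n\<rangle>) \<noteq> None)"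

definition correct_answers :: "baire \<Rightarrow> baire \<Rightarrow> bool" where
  "correct_answers h q \<longleftrightarrow>
     (\<forall>i A. closed_rep (\<lambda>n. h \<langle>i, n\<rangle>) = Some A \<longrightarrow> A \<noteq> {} \<longrightarrow> (\<lambda>n. q \<langle>i, n\<rangle>) \<in> A)"

lemma baire_pair_even [simp]: "baire_pair p q (2 * n) = p n"
  and baire_pair_odd [simp]: "baire_pair p q (Suc (2 * n)) = q n"
  by (simp_all add: baire_pair_def)

lemma closed_rep_closed: "closed_rep p = Some A \<Longrightarrow> closed A"
  by (auto simp: closed_rep_def closed_paths split: if_splits)

lemma realizes_UC_iff:
  "realizes G UC_baire \<longleftrightarrow> (\<forall>p x. closed_rep p = Some {x} \<longrightarrow> G p = Some x)"
proof
  assume G: "realizes G UC_baire"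
  show "\<forall>p x. closed_rep p = Some {x} \<longrightarrow> G p = Some x"
  proof (intro allI impI)
    fix p x
    assume p: "closed_rep p = Some {x}"
    then show "G p = Some x"
      using G[unfolded realizes_def, rule_format, of p "{x}"] closed_rep_closed[OF p]
      by (auto simp: UC_baire_def baire_rep_def)
  qed
qed (auto simp: realizes_def UC_baire_def baire_rep_def)

text \<open>Every valid sequence of names lies in the domain, because an empty set accepts any
  answer.\<close>

lemma realizes_parallelization_TC_iff:
  "realizes G (parallelization TC_baire) \<longleftrightarrow>
     (\<forall>h. valid_instances h \<longrightarrow> (\<exists>q. G h = Some q \<and> correct_answers h q))"
proof -
  have sol: "solutions (parallelization TC_baire) (\<lambda>i. the (closed_rep (\<lambda>n. h \<langle>i, n\<rangle>))) =
      {ys. \<forall>i. the (closed_rep (\<lambda>n. h \<langle>i, n\<rangle>)) \<noteq> {} \<longrightarrow> ys i \<in> the (closed_rep (\<lambda>n. h \<langle>i, n\<rangle>))}"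
    if "valid_instances h" for h
  proof -
    have "closed (the (closed_rep (\<lambda>n. h \<langle>i, n\<rangle>)))" for i
      using that closed_rep_closed by (auto simp: valid_instances_def)
    then show ?thesis by (simp add: parallelization_def TC_baire_def)
  qed
  have nonempty: "solutions (parallelization TC_baire) (\<lambda>i. the (closed_rep (\<lambda>n. h \<langle>i, n\<rangle>))) \<noteq> {}"
    if "valid_instances h" for h
  proof -
    have "(\<lambda>i. SOME x. x \<in> the (closed_rep (\<lambda>n. h \<langle>i, n\<rangle>))) \<in>
        solutions (parallelization TC_baire) (\<lambda>i. the (closed_rep (\<lambda>n. h \<langle>i, n\<rangle>)))"
      unfolding sol[OF that] by (simp add: some_in_eq)
    then show ?thesis by blast
  qed
  have correct: "(\<lambda>i n. q \<langle>i, n\<rangle>) \<in> solutions (parallelization TC_baire) (\<lambda>i. the (closed_rep (\<lambda>n. h \<langle>i, n\<rangle>)))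
      \<longleftrightarrow> correct_answers h q" if "valid_instances h" for h q
  proof -
    have "\<exists>A. closed_rep (\<lambda>n. h \<langle>i, n\<rangle>) = Some A" for i
      using that by (auto simp: valid_instances_def)
    then obtain A where "\<And>i. closed_rep (\<lambda>n. h \<langle>i, n\<rangle>) = Some (A i)" by metis
    then show ?thesis unfolding sol[OF that] correct_answers_def by simp
  qed
  have in_rep: "in_rep (parallelization TC_baire) h = Some xs \<longleftrightarrow>
      valid_instances h \<and> xs = (\<lambda>i. the (closed_rep (\<lambda>n. h \<langle>i, n\<rangle>)))" for h xs
    by (auto simp: parallelization_def TC_baire_def seq_rep_def valid_instances_def)
  have out_rep: "out_rep (parallelization TC_baire) q = Some ys \<longleftrightarrow> ys = (\<lambda>i n. q \<langle>i, n\<rangle>)" for q ys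
    by (auto simp: parallelization_def TC_baire_def seq_rep_def baire_rep_def)
  have "realizes G (parallelization TC_baire) \<longleftrightarrow>
      (\<forall>h. valid_instances h \<longrightarrow> (\<exists>q. G h = Some q \<and> (\<lambda>i n. q \<langle>i, n\<rangle>) \<in>
        solutions (parallelization TC_baire) (\<lambda>i. the (closed_rep (\<lambda>n. h \<langle>i, n\<rangle>)))))"
    by (simp add: realizes_def in_rep out_rep nonempty cong: conj_cong)
  then show ?thesis by (simp only: correct cong: imp_cong)
qed

lemma ex_correct_answers: "\<exists>q. correct_answers h q"
proof -
  define q where "q = (\<lambda>k. (SOME x. x \<in> the (closed_rep (\<lambda>n. h \<langle>pfst k, n\<rangle>))) (psnd k))"
  have "(\<lambda>n. q \<langle>i, n\<rangle>) = (SOME x. x \<in> the (closed_rep (\<lambda>n. h \<langle>i, n\<rangle>)))" for i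
    by (simp add: q_def)
  then have "correct_answers h q"
    by (auto simp: correct_answers_def some_in_eq)
  then show ?thesis by blast
qed

lemma realizes_single_valued_iff:
  "realizes F (single_valued_problem \<delta> baire_rep f) \<longleftrightarrow>
     (\<forall>p x y. \<delta> p = Some x \<longrightarrow> f x = Some y \<longrightarrow> F p = Some y)"
proof -
  have "realizes F (single_valued_problem \<delta> baire_rep f) \<longleftrightarrow>
      (\<forall>p x. \<delta> p = Some x \<and> (\<exists>y. f x = Some y) \<longrightarrow> (\<exists>q. F p = Some q \<and> f x = Some q))"
    by (simp add: realizes_def single_valued_problem_def baire_rep_def)
  then show ?thesis by (metis option.inject)
qed

lemma computable_total: "total_rec g \<Longrightarrow> computable (\<lambda>p. Some (g p))"
  unfolding computable_def total_rec_def by (intro exI[of _ "\<lambda>p n. Some (g p n)"]) auto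

lemma UC_le_parallelization_TC:
  assumes "f \<le>\<^sub>W UC_baire"
  shows "f \<le>\<^sub>W parallelization TC_baire"
proof -
  obtain H K where H: "computable H" and K: "computable K" and red: "\<And>G. realizes G UC_baire \<Longrightarrow>
      realizes (\<lambda>p. Option.bind (H p) (\<lambda>h. Option.bind (G h) (\<lambda>q. K (baire_pair p q)))) f"
    using assms by (auto simp: weihrauch_le_def)
  \<comment> \<open>The odd entries of the pair carry \<open>h\<close>, so every row of the new
    instance is \<open>h\<close>; \<open>K'\<close> reads row 0 of the answers.\<close>
  define H' where "H' = (\<lambda>p. map_option (\<lambda>h n. baire_pair p h (Suc (2 * psnd n))) (H p))"
  define K' where "K' = (\<lambda>r. K (baire_pair (\<lambda>n. r (2 * n)) (\<lambda>n. r (Suc (2 * \<langle>0, n\<rangle>)))))"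
  have "computable H'"
    unfolding H'_def by (intro computable_postcompose[OF H] total_rec_intros)
  moreover have "computable K'"
    unfolding K'_def by (rule computable_precompose[OF K]) (intro total_rec_intros)
  moreover have "realizes (\<lambda>p. Option.bind (H' p) (\<lambda>h. Option.bind (G h) (\<lambda>q. K' (baire_pair p q)))) f"
    if G: "realizes G (parallelization TC_baire)" for G
  proof -
    define G' where "G' = (\<lambda>h. map_option (\<lambda>q n. q \<langle>0, n\<rangle>) (G (\<lambda>n. h (psnd n))))"
    have "G' h = Some x" if h: "closed_rep h = Some {x}" for h x
    proof -
      have "valid_instances (\<lambda>n. h (psnd n))"
        using h by (simp add: valid_instances_def)
      then obtain q where "G (\<lambda>n. h (psnd n)) = Some q" "correct_answers (\<lambda>n. h (psnd n)) q"
        using G by (auto simp: realizes_parallelization_TC_iff)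
      then show ?thesis using h by (simp add: G'_def correct_answers_def)
    qed
    then have "realizes (\<lambda>p. Option.bind (H p) (\<lambda>h. Option.bind (G' h) (\<lambda>q. K (baire_pair p q)))) f"
      by (intro red) (simp add: realizes_UC_iff)
    moreover have "Option.bind (H p) (\<lambda>h. Option.bind (G' h) (\<lambda>q. K (baire_pair p q))) =
        Option.bind (H' p) (\<lambda>h. Option.bind (G h) (\<lambda>q. K' (baire_pair p q)))" for p
    proof (cases "H p")
      case (Some h)
      then show ?thesis
        by (cases "G (\<lambda>n. h (psnd n))")
          (simp_all add: H'_def G'_def K'_def)
    qed (simp add: H'_def)
    ultimately show ?thesis by simp
  qed
  ultimately show ?thesis unfolding weihrauch_le_def by blast
qed

text \<open>An element \<open>x\<close> of the closed set codes a triple \<open>(y, S, r)\<close> by \<open>y n = x \<langle>0, n\<rangle>\<close>,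
  \<open>S = {i. x \<langle>1, i\<rangle> \<noteq> 0}\<close> and \<open>r\<^sub>i n = x \<langle>2, \<langle>i, n\<rangle>\<rangle>\<close>.  By continuity it suffices to fill up \<open>r\<close>
  outside of \<open>S\<close> by finite sequences.\<close>

lemma single_value_pi01:
  assumes "recursive_functional \<Phi>"
  obtains P where "decidable2 P"
    and "\<And>p h y. valid_instances h \<Longrightarrow>
          (\<And>q n. correct_answers h q \<Longrightarrow> \<Phi> (baire_pair p q) n = Some (y n)) \<Longrightarrow>
          (\<exists>x. \<forall>k. P (baire_pair p h) x k) \<and>
          (\<forall>x. (\<forall>k. P (baire_pair p h) x k) \<longrightarrow> (\<forall>n. x \<langle>0, n\<rangle> = y n))"
proof -
  obtain A where A: "approximates A \<Phi>" using approximation[OF assms] by blast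
  \<comment> \<open>Outside \<open>S\<close> the answers come from the finite sequence coded by
    \<open>t\<close>, continued by zeros.\<close>
  define fill :: "baire \<Rightarrow> nat \<Rightarrow> baire"
    where "fill = (\<lambda>x t k. if x \<langle>1, pfst k\<rangle> \<noteq> 0 then x \<langle>2, k\<rangle> else list_nth t k)"
  \<comment> \<open>With \<open>k\<close> coding an index \<open>i\<close> and a word, this says
    that each prefix of \<open>r\<^sub>i\<close> lies in the tree \<open>T\<^sub>i\<close>; the
    entry of \<open>a\<close> at \<open>Suc (2 * k)\<close> is the bit of the tree name.\<close>
  define P1 where "P1 = (\<lambda>a x k. x \<langle>1, pfst k\<rangle> \<noteq> 0 \<and>
      (\<forall>j<list_len (psnd k). list_nth (psnd k) j = x \<langle>2, \<langle>pfst k, j\<rangle>\<rangle>) \<longrightarrow> a (Suc (2 * k)) = (1::nat))"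
  \<comment> \<open>Here \<open>k\<close> codes \<open>t\<close>, a digit position \<open>n\<close>
    and a stage: the stage is still silent or outputs the digit \<open>n\<close> of
    \<open>y\<close>.\<close>
  define P2 where "P2 = (\<lambda>a x k.
      option_code (A (baire_pair (\<lambda>i. a (2 * i)) (fill x (pfst k))) (psnd (psnd k)) (pfst (psnd k))) = 0 \<or>
      option_code (A (baire_pair (\<lambda>i. a (2 * i)) (fill x (pfst k))) (psnd (psnd k)) (pfst (psnd k))) =
        Suc (x \<langle>0, pfst (psnd k)\<rangle>))"
  define P where "P = (\<lambda>a x k. P1 a x (pfst k) \<and> P2 a x (psnd k))"
  have approx: "total_rec (\<lambda>p n. option_code (A (\<lambda>i. g p n i) (b p n) (c p n)))"
    if "total_rec (\<lambda>p m. g p (pfst m) (psnd m))" "total_rec b" "total_rec c" for g b c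
    using total_rec_substitution[OF approximatesD(1)[OF A] that(1) total_rec_pair[OF that(2,3)]]
    by simp
  have "decidable2 P"
    unfolding P_def P1_def P2_def fill_def by (intro total_rec_intros approx)
  moreover have "(\<exists>x. \<forall>k. P (baire_pair p h) x k) \<and>
      (\<forall>x. (\<forall>k. P (baire_pair p h) x k) \<longrightarrow> (\<forall>n. x \<langle>0, n\<rangle> = y n))"
    if valid: "valid_instances h"
      and y: "\<And>q n. correct_answers h q \<Longrightarrow> \<Phi> (baire_pair p q) n = Some (y n)" for p h y
  proof -
    define T where "T = (\<lambda>i. coded_set (\<lambda>n. h \<langle>i, n\<rangle>))"
    have T: "closed_rep (\<lambda>n. h \<langle>i, n\<rangle>) = Some (paths (T i))" for i
    proof -
      have "closed_rep (\<lambda>n. h \<langle>i, n\<rangle>) \<noteq> None"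
        using valid unfolding valid_instances_def by blast
      then show ?thesis unfolding closed_rep_def T_def by metis
    qed
    have correct: "correct_answers h q \<longleftrightarrow> (\<forall>i. paths (T i) \<noteq> {} \<longrightarrow> (\<lambda>n. q \<langle>i, n\<rangle>) \<in> paths (T i))" for q
      by (simp add: correct_answers_def T)
    have P1: "(\<forall>k. P1 (baire_pair p h) x k) \<longleftrightarrow>
        (\<forall>i. x \<langle>1, i\<rangle> \<noteq> 0 \<longrightarrow> (\<lambda>n. x \<langle>2, \<langle>i, n\<rangle>\<rangle>) \<in> paths (T i))" for x
    proof -
      have path: "(\<forall>w. (\<forall>j<length w. w ! j = x \<langle>2, \<langle>i, j\<rangle>\<rangle>) \<longrightarrow> w \<in> T i) \<longleftrightarrow>
          (\<lambda>n. x \<langle>2, \<langle>i, n\<rangle>\<rangle>) \<in> paths (T i)" for i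
      proof
        assume "(\<lambda>n. x \<langle>2, \<langle>i, n\<rangle>\<rangle>) \<in> paths (T i)"
        then have T: "map (\<lambda>n. x \<langle>2, \<langle>i, n\<rangle>\<rangle>) [0..<N] \<in> T i" for N by (simp add: paths_def)
        have "w = map (\<lambda>n. x \<langle>2, \<langle>i, n\<rangle>\<rangle>) [0..<length w]" if "\<forall>j<length w. w ! j = x \<langle>2, \<langle>i, j\<rangle>\<rangle>" for w
          using that by (intro nth_equalityI) auto
        with T show "\<forall>w. (\<forall>j<length w. w ! j = x \<langle>2, \<langle>i, j\<rangle>\<rangle>) \<longrightarrow> w \<in> T i" by metis
      qed (simp add: paths_def)
      have "(\<forall>k. P1 (baire_pair p h) x k) \<longleftrightarrow> (\<forall>i w. P1 (baire_pair p h) x \<langle>i, list_encode w\<rangle>)"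
        by (metis pair_pfst_psnd list_decode_inverse)
      also have "\<dots> \<longleftrightarrow> (\<forall>i. x \<langle>1, i\<rangle> \<noteq> 0 \<longrightarrow>
          (\<forall>w. (\<forall>j<length w. w ! j = x \<langle>2, \<langle>i, j\<rangle>\<rangle>) \<longrightarrow> w \<in> T i))"
        by (auto simp: P1_def list_nth_encode baire_pair_def T_def coded_set_def)
      finally show ?thesis by (simp only: path)
    qed
    have P2: "(\<forall>k. P2 (baire_pair p h) x k) \<longleftrightarrow>
        (\<forall>t N n v. A (baire_pair p (fill x t)) N n = Some v \<longrightarrow> v = x \<langle>0, n\<rangle>)" for x
    proof -
      have code: "option_code w = 0 \<or> option_code w = Suc c \<longleftrightarrow> (\<forall>v. w = Some v \<longrightarrow> v = c)" for w c
        by (cases w) auto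
      have "(\<forall>k. P2 (baire_pair p h) x k) \<longleftrightarrow> (\<forall>t n N. P2 (baire_pair p h) x \<langle>t, \<langle>n, N\<rangle>\<rangle>)"
        by (metis pair_pfst_psnd)
      also have "\<dots> \<longleftrightarrow> (\<forall>t N n v. A (baire_pair p (fill x t)) N n = Some v \<longrightarrow> v = x \<langle>0, n\<rangle>)"
        unfolding P2_def code pfst_pair psnd_pair baire_pair_even by blast
      finally show ?thesis .
    qed
    have P: "(\<forall>k. P (baire_pair p h) x k) \<longleftrightarrow>
        (\<forall>k. P1 (baire_pair p h) x k) \<and> (\<forall>k. P2 (baire_pair p h) x k)" for x
      unfolding P_def by (metis pfst_pair psnd_pair)
    obtain r where r: "correct_answers h r" using ex_correct_answers by blast
    show ?thesis
    proof (intro conjI allI impI)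
      \<comment> \<open>The triple of the true value, the set of all indices with a nonempty
        instance, and correct answers. Any filling outside this set remains correct.\<close>
      define x where "x = (\<lambda>k. if pfst k = 0 then y (psnd k)
        else if pfst k = 1 then of_bool (paths (T (psnd k)) \<noteq> {}) else r (psnd k))"
      have fill: "correct_answers h (fill x t)" for t
        using r by (auto simp: correct fill_def x_def)
      have xA: "v = y n" if "A (baire_pair p (fill x t)) N n = Some v" for t N n v
      proof -
        have "\<Phi> (baire_pair p (fill x t)) n = Some v"
          using that approximatesD(4)[OF A] by blast
        with y[OF fill, of t n] show ?thesis by simp
      qed
      have "\<forall>k. P (baire_pair p h) x k"
        using r xA unfolding P P1 P2 correct by (auto simp: x_def)
      then show "\<exists>x. \<forall>k. P (baire_pair p h) x k" by blast
    next
      fix x n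
      assume "\<forall>k. P (baire_pair p h) x k"
      then have x1: "\<And>i. x \<langle>1, i\<rangle> \<noteq> 0 \<Longrightarrow> (\<lambda>n. x \<langle>2, \<langle>i, n\<rangle>\<rangle>) \<in> paths (T i)"
        and x2: "\<And>t N n v. A (baire_pair p (fill x t)) N n = Some v \<Longrightarrow> v = x \<langle>0, n\<rangle>"
        unfolding P P1 P2 by blast+
      \<comment> \<open>Keeping \<open>r\<close> of the triple on \<open>S\<close> and using correct
        answers elsewhere gives correct answers, on which \<open>\<Phi>\<close> outputs
        \<open>y\<close>.\<close>
      define q where "q = (\<lambda>k. if x \<langle>1, pfst k\<rangle> \<noteq> 0 then x \<langle>2, k\<rangle> else r k)"
      have "correct_answers h q"
        unfolding correct
      proof (intro allI impI)
        fix i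
        assume "paths (T i) \<noteq> {}"
        then show "(\<lambda>n. q \<langle>i, n\<rangle>) \<in> paths (T i)"
          using x1[of i] r by (cases "x \<langle>1, i\<rangle> = 0") (auto simp: q_def correct)
      qed
      then obtain N where N: "A (baire_pair p q) N n = Some (y n)"
        using y approximatesD(4)[OF A] by blast
      \<comment> \<open>Stage \<open>N\<close> reads oracle positions below \<open>N\<close> only,
        so the first \<open>N\<close> entries of \<open>q\<close> suffice as filling.\<close>
      define t where "t = list_encode (map q [0..<N])"
      have "A (baire_pair p (fill x t)) N n = A (baire_pair p q) N n"
      proof (rule approximatesD(2)[OF A])
        fix i
        assume "i < N"
        then have "i div 2 < N" by simp
        then show "baire_pair p (fill x t) i = baire_pair p q i"
          by (auto simp: baire_pair_def fill_def q_def t_def list_nth_encode)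
      qed
      with N x2 show "x \<langle>0, n\<rangle> = y n" by metis
    qed
  qed
  ultimately show ?thesis by (rule that)
qed

text \<open>Any correct answers can be returned by some realizer, so \<open>K\<close> must produce
  the same \<open>y\<close> on all of them; this is where single-valuedness enters.\<close>

lemma single_valued_le_UC:
  assumes "single_valued_problem \<delta> baire_rep f \<le>\<^sub>W parallelization TC_baire"
  shows "single_valued_problem \<delta> baire_rep f \<le>\<^sub>W UC_baire"
proof -
  obtain H K where H: "computable H" and K: "computable K"
    and red: "\<And>G. realizes G (parallelization TC_baire) \<Longrightarrow>
      realizes (\<lambda>p. Option.bind (H p) (\<lambda>h. Option.bind (G h) (\<lambda>q. K (baire_pair p q))))
        (single_valued_problem \<delta> baire_rep f)"
    using assms by (auto simp: weihrauch_le_def)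
  obtain \<Phi> where \<Phi>: "recursive_functional \<Phi>" "\<And>r q n. K r = Some q \<Longrightarrow> \<Phi> r n = Some (q n)"
    using K by (auto simp: computable_def)
  obtain P where P: "decidable2 P"
    and single: "\<And>p h y. valid_instances h \<Longrightarrow>
          (\<And>q n. correct_answers h q \<Longrightarrow> \<Phi> (baire_pair p q) n = Some (y n)) \<Longrightarrow>
          (\<exists>x. \<forall>k. P (baire_pair p h) x k) \<and>
          (\<forall>x. (\<forall>k. P (baire_pair p h) x k) \<longrightarrow> (\<forall>n. x \<langle>0, n\<rangle> = y n))"
    using single_value_pi01[OF \<Phi>(1)] by blast
  obtain e where e: "total_rec e"
    and name: "\<And>a y. \<exists>x. \<forall>k. P a x k \<Longrightarrow> (\<And>x n. \<forall>k. P a x k \<Longrightarrow> x \<langle>0, n\<rangle> = y n) \<Longrightarrow>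
           \<exists>u. closed_rep (e a) = Some {u} \<and> (\<forall>n. u (list_encode [n]) = Suc (y n))"
    using singleton_value_name[OF P] by blast
  define H' where "H' = (\<lambda>p. map_option (\<lambda>h. e (baire_pair p h)) (H p))"
  \<comment> \<open>\<open>Suc \<langle>n, 0\<rangle>\<close> is the code of \<open>[n]\<close>, the
    answer sits at the odd entries, and subtracting 1 undoes the successor in the value of the
    game.\<close>
  define K' :: "baire \<Rightarrow> baire option" where "K' = (\<lambda>r. Some (\<lambda>n. r (Suc (2 * Suc \<langle>n, 0\<rangle>)) - 1))"
  have "computable H'"
    unfolding H'_def by (rule computable_postcompose[OF H e])
  moreover have "computable K'"
    unfolding K'_def by (intro computable_total total_rec_intros)
  moreover have "Option.bind (H' p) (\<lambda>h. Option.bind (G h) (\<lambda>q. K' (baire_pair p q))) = Some y"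
    if G: "realizes G UC_baire" and p: "\<delta> p = Some x" "f x = Some y" for G p x y
  proof -
    \<comment> \<open>Leaving this realizer undefined on invalid sequences forces \<open>H p\<close>
      to be defined and valid.\<close>
    define G0 where "G0 = (\<lambda>h. if valid_instances h then Some (SOME q. correct_answers h q) else None)"
    have G0: "realizes G0 (parallelization TC_baire)"
      unfolding realizes_parallelization_TC_iff G0_def using someI_ex[OF ex_correct_answers] by simp
    obtain h where h: "H p = Some h" "valid_instances h"
      using red[OF G0] p unfolding realizes_single_valued_iff
      by (auto simp: bind_eq_Some_conv G0_def split: if_splits)
    have "K (baire_pair p q) = Some y" if "correct_answers h q" for q
    proof -
      \<comment> \<open>Changing the realizer at \<open>h\<close> alone makes it return the chosen
        \<open>q\<close>.\<close>
      have "realizes (G0(h := Some q)) (parallelization TC_baire)"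
        using G0 that by (simp add: realizes_parallelization_TC_iff)
      from red[OF this, unfolded realizes_single_valued_iff, rule_format, OF p] show ?thesis
        using h by simp
    qed
    then have "\<Phi> (baire_pair p q) n = Some (y n)" if "correct_answers h q" for q n
      using \<Phi>(2) that by blast
    note single = single[OF h(2) this]
    have "\<exists>u. closed_rep (e (baire_pair p h)) = Some {u} \<and> (\<forall>n. u (list_encode [n]) = Suc (y n))"
    proof (rule name)
      show "\<exists>x. \<forall>k. P (baire_pair p h) x k" using single by blast
      show "x \<langle>0, n\<rangle> = y n" if "\<forall>k. P (baire_pair p h) x k" for x n
        using single that by blast
    qed
    then obtain u where u: "closed_rep (e (baire_pair p h)) = Some {u}"
        "\<And>n. u (list_encode [n]) = Suc (y n)"
      by blast
    then have "G (e (baire_pair p h)) = Some u"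
      using G by (simp add: realizes_UC_iff)
    with h u(2) show ?thesis
      by (simp add: H'_def K'_def baire_pair_def)
  qed
  ultimately show ?thesis
    unfolding weihrauch_le_def realizes_single_valued_iff by blast
qed

theorem theorem8p5:
  fixes X :: "'x set" and \<delta> :: "'x rep" and f :: "'x \<Rightarrow> baire option"
  assumes "represented_space X \<delta>"
    and "dom f \<subseteq> X"
  shows "single_valued_problem \<delta> baire_rep f \<le>\<^sub>W UC_baire \<longleftrightarrow>
         single_valued_problem \<delta> baire_rep f \<le>\<^sub>W parallelization TC_baire"
  by (rule iffI[OF UC_le_parallelization_TC single_valued_le_UC])

end
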